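(* Let $M$ be a correspondence over a unital $C^*$-algebra $A$ such that $M$ is essential as a left $A$-module. Suppose that $\{m_j:j\ge0\}$ is a (finite or countably infinite) Parseval frame for $M$ with $\langle m_0,m_0\rangle=1$, and that $(X,D,\phi)$ is a scaling function for $m_0$. Let $(M_\infty,\iota^k)=\varinjlim(M^{\otimes k},T_k)$, where $T_0a=m_0\cdot a$ on $M^{\otimes 0}=A$ and $T_kn=m_0\otimes n$ for $n\in M^{\otimes k}$, $k\ge1$, let $R:M_\infty\to M_\infty\otimes_AM$ be the Hilbert-module isomorphism with $R\circ\iota^{k+1}=\iota^k\otimes\mathrm{id}$ for $k\ge0$, and let $Q:M_\infty\to X$ be the inner-product preserving map such that $Q(\iota^0(1))=\phi$ and $D\circ Q=(Q\otimes\mathrm{id})\circ R$. Then $$\{\phi\}\cup\Big\{D^{-k}\Big(\phi\otimes\Big(\bigotimes_{l=1}^km_{j_l}\Big)\Big):k\ge1,\ j_l\ge0\text{ and }j_1>0\Big\}$$ is a Parseval frame for the submodule $Q(M_\infty)$ of $X$. It is orthonormal if $\{m_j\}$ is.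
   Context: All Hilbert modules are right Hilbert $A$-modules, with inner product $A$-linear in the second variable. A correspondence over $A$ is a right Hilbert $A$-module $M$ with a left action given by a $*$-homomorphism $A\to\mathcal L(M)$; it is essential as a left module if $1_A\cdot n=n$ for all $n\in M$. $X\otimes_AM$ is the internal (balanced) tensor product with $\langle x\otimes n,y\otimes n'\rangle=\langle n,\langle x,y\rangle\cdot n'\rangle$, $M^{\otimes k}$ is the $k$-fold internal tensor power, $\mathrm{id}_k$ its identity map, $M^{\otimes 0}=A_A$. For $S$ inner-product preserving, $(S\otimes\mathrm{id})(x\otimes n)=(Sx)\otimes n$. $A\otimes_AM$ is identified with $M$ via $a\otimes n\mapsto a\cdot n$. A scaling function for an element $m_0\in M$ with $\langle m_0,m_0\rangle=1_A$ is a triple $(X,D,\phi)$ consisting of a Hilbert $A$-module $X$, a Hilbert-module isomorphism (surjective inner-product preserving map) $D:X\to X\otimes_AM$, and $\phi\in X$ with $\langle\phi,\phi\rangle=1_A$ and $D\phi=\phi\otimes m_0$. The powers of $D$ are $D^0=\mathrm{id}$, $D^1=D$, $D^{k+1}=(D\otimes\mathrm{id}_k)\circ D^k:X\to X\otimes_AM^{\otimes(k+1)}$, and $D^{-k}=(D^k)^{-1}$. $\varinjlim(X_k,T_k)$, for inner-product preserving $T_k:X_k\to X_{k+1}$, is the Hilbert-module direct limit: the completion $X_\infty$ of the quotient of $\bigsqcup_kX_k$ in which $x\in X_k$ is identified with $T_kx\in X_{k+1}$, with canonical inner-product preserving maps $\iota^k:X_k\to X_\infty$ satisfying $\iota^{k+1}\circ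 T_k=\iota^k$. It is known that $R$ and $Q$ as described exist (they are then unique). A countable family $\{x_j:j\in J\}$ in a Hilbert $A$-module $Z$ is a Parseval frame for $Z$ if $\langle x,x\rangle=\sum_{j\in J}\langle x,x_j\rangle\langle x_j,x\rangle$ for every $x\in Z$, with norm convergence in $A$. It is an orthonormal basis if it generates $Z$ (as a closed submodule) and $\langle x_j,x_k\rangle=\delta_{j,k}1_A$; "orthonormal" in the claim means that if $\{m_j\}$ is an orthonormal basis for $M$ then the displayed family is an orthonormal basis for $Q(M_\infty)$. The displayed set is understood as a family indexed by the tuples $(j_1,\dots,j_k)$ together with the extra element $\phi$. *)

theory Defs
  imports "HOL-Analysis.Analysis"
begin

text \<open>
  The class does not assume \<open>0 \<noteq> 1\<close>
  or \<open>norm 1 = 1\<close>, so the zero algebra is allowed.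
\<close>

class unital_cstar_algebra = real_normed_algebra + banach + monoid_mult +
  fixes scaleC :: "complex \<Rightarrow> 'a \<Rightarrow> 'a"
    and star :: "'a \<Rightarrow> 'a"
  assumes scaleC_add_right: "scaleC c (a + b) = scaleC c a + scaleC c b"
    and scaleC_add_left: "scaleC (c + d) a = scaleC c a + scaleC d a"
    and scaleC_scaleC: "scaleC c (scaleC d a) = scaleC (c * d) a"
    and scaleC_of_real: "scaleC (complex_of_real r) a = scaleR r a"
    and mult_scaleC_left: "scaleC c a * b = scaleC c (a * b)"
    and mult_scaleC_right: "a * scaleC c b = scaleC c (a * b)"
    and norm_scaleC: "norm (scaleC c a) = cmod c * norm a"
    and star_add: "star (a + b) = star a + star b"
    and star_scaleC: "star (scaleC c a) = scaleC (cnj c) (star a)"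
    and star_mult: "star (a * b) = star b * star a"
    and star_star: "star (star a) = a"
    and cstar_identity: "norm (star a * a) = (norm a)\<^sup>2"

definition positive :: "'a::unital_cstar_algebra \<Rightarrow> bool" where
  "positive a \<longleftrightarrow> (\<exists>b. a = star b * b)"

text \<open>
  Modules are records with an explicit carrier, because the tensor powers of a module
  form a family of modules indexed by a natural number. As the algebra is unital, the
  complex scalar multiplication of a module is \<open>x \<cdot> (scaleC c 1)\<close> and needs no field.
\<close>

record ('x, 'a) hmod =
  hcar :: "'x set"
  hadd :: "'x \<Rightarrow> 'x \<Rightarrow> 'x"
  hzero :: "'x"
  ract :: "'x \<Rightarrow> 'a \<Rightarrow> 'x"
  ip :: "'x \<Rightarrow> 'x \<Rightarrow> 'a"

definition hdist :: "('x, 'a::unital_cstar_algebra, 'z) hmod_scheme \<Rightarrow> 'x \<Rightarrow> 'x \<Rightarrow> real" where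
  "hdist X x y = (let d = hadd X x (ract X y (- 1)) in sqrt (norm (ip X d d)))"

locale hilbert_module =
  fixes X :: "('x, 'a::unital_cstar_algebra, 'z) hmod_scheme"
  assumes zero_closed: "hzero X \<in> hcar X"
    and add_closed: "\<lbrakk>x \<in> hcar X; y \<in> hcar X\<rbrakk> \<Longrightarrow> hadd X x y \<in> hcar X"
    and add_assoc: "\<lbrakk>x \<in> hcar X; y \<in> hcar X; z \<in> hcar X\<rbrakk>
          \<Longrightarrow> hadd X (hadd X x y) z = hadd X x (hadd X y z)"
    and add_commute: "\<lbrakk>x \<in> hcar X; y \<in> hcar X\<rbrakk> \<Longrightarrow> hadd X x y = hadd X y x"
    and add_zero: "x \<in> hcar X \<Longrightarrow> hadd X x (hzero X) = x"
    and add_inverse: "x \<in> hcar X \<Longrightarrow> \<exists>y\<in>hcar X. hadd X x y = hzero X"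
    and ract_closed: "x \<in> hcar X \<Longrightarrow> ract X x a \<in> hcar X"
    and ract_add_left: "\<lbrakk>x \<in> hcar X; y \<in> hcar X\<rbrakk>
          \<Longrightarrow> ract X (hadd X x y) a = hadd X (ract X x a) (ract X y a)"
    and ract_add_right: "x \<in> hcar X \<Longrightarrow> ract X x (a + b) = hadd X (ract X x a) (ract X x b)"
    and ract_mult: "x \<in> hcar X \<Longrightarrow> ract X x (a * b) = ract X (ract X x a) b"
    and ract_one: "x \<in> hcar X \<Longrightarrow> ract X x 1 = x"
    and ip_add_right: "\<lbrakk>x \<in> hcar X; y \<in> hcar X; z \<in> hcar X\<rbrakk>
          \<Longrightarrow> ip X x (hadd X y z) = ip X x y + ip X x z"
    and ip_ract_right: "\<lbrakk>x \<in> hcar X; y \<in> hcar X\<rbrakk> \<Longrightarrow> ip X x (ract X y a) = ip X x y * a"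
    and ip_star: "\<lbrakk>x \<in> hcar X; y \<in> hcar X\<rbrakk> \<Longrightarrow> ip X y x = star (ip X x y)"
    and ip_positive: "x \<in> hcar X \<Longrightarrow> positive (ip X x x)"
    and ip_definite: "\<lbrakk>x \<in> hcar X; ip X x x = 0\<rbrakk> \<Longrightarrow> x = hzero X"
    and complete: "\<lbrakk>\<And>n. s n \<in> hcar X;
            \<And>e. e > 0 \<Longrightarrow> \<exists>N. \<forall>i\<ge>N. \<forall>j\<ge>N. hdist X (s i) (s j) < e\<rbrakk>
          \<Longrightarrow> \<exists>x\<in>hcar X. (\<lambda>n. hdist X (s n) x) \<longlonglongrightarrow> 0"

definition ip_preserving ::
  "('x, 'a, 'z) hmod_scheme \<Rightarrow> ('y, 'a, 'w) hmod_scheme \<Rightarrow> ('x \<Rightarrow> 'y) \<Rightarrow> bool" where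
  "ip_preserving X Y f \<longleftrightarrow>
     (\<forall>x\<in>hcar X. f x \<in> hcar Y) \<and>
     (\<forall>x\<in>hcar X. \<forall>x'\<in>hcar X. ip Y (f x) (f x') = ip X x x')"

text \<open>Additivity and \<open>A\<close>-linearity of an inner-product preserving map are automatic.\<close>

definition hmod_iso ::
  "('x, 'a, 'z) hmod_scheme \<Rightarrow> ('y, 'a, 'w) hmod_scheme \<Rightarrow> ('x \<Rightarrow> 'y) \<Rightarrow> bool" where
  "hmod_iso X Y f \<longleftrightarrow> ip_preserving X Y f \<and> f ` hcar X = hcar Y"

inductive_set hspan :: "('x, 'a, 'z) hmod_scheme \<Rightarrow> 'x set \<Rightarrow> 'x set"
  for X :: "('x, 'a, 'z) hmod_scheme" and S :: "'x set" where
  hspan_zero: "hzero X \<in> hspan X S"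
| hspan_base: "x \<in> S \<Longrightarrow> x \<in> hspan X S"
| hspan_add: "\<lbrakk>x \<in> hspan X S; y \<in> hspan X S\<rbrakk> \<Longrightarrow> hadd X x y \<in> hspan X S"
| hspan_ract: "x \<in> hspan X S \<Longrightarrow> ract X x a \<in> hspan X S"

definition hdense :: "('x, 'a::unital_cstar_algebra, 'z) hmod_scheme \<Rightarrow> 'x set \<Rightarrow> bool" where
  "hdense X S \<longleftrightarrow> S \<subseteq> hcar X \<and> (\<forall>x\<in>hcar X. \<forall>e>0. \<exists>y\<in>S. hdist X x y < e)"

text \<open>
  A sum of a family over a set is the norm limit of the net of its finite partial sums
  (\<open>has_sum\<close>).
\<close>

definition parseval_frame ::
  "('x, 'a::unital_cstar_algebra, 'z) hmod_scheme \<Rightarrow> 'j set \<Rightarrow> ('j \<Rightarrow> 'x) \<Rightarrow> bool" where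
  "parseval_frame Z J f \<longleftrightarrow>
     hilbert_module Z \<and> countable J \<and> (\<forall>j\<in>J. f j \<in> hcar Z) \<and>
     (\<forall>x\<in>hcar Z. ((\<lambda>j. ip Z x (f j) * ip Z (f j) x) has_sum ip Z x x) J)"

definition orthonormal_basis ::
  "('x, 'a::unital_cstar_algebra, 'z) hmod_scheme \<Rightarrow> 'j set \<Rightarrow> ('j \<Rightarrow> 'x) \<Rightarrow> bool" where
  "orthonormal_basis Z J f \<longleftrightarrow>
     hilbert_module Z \<and> countable J \<and> (\<forall>j\<in>J. f j \<in> hcar Z) \<and>
     hdense Z (hspan Z (f ` J)) \<and>
     (\<forall>j\<in>J. \<forall>k\<in>J. ip Z (f j) (f k) = (if j = k then 1 else 0))"

record ('x, 'a) corr = "('x, 'a) hmod" +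
  lact :: "'a \<Rightarrow> 'x \<Rightarrow> 'x"

text \<open>
  The left action is a *-homomorphism into the adjointable operators: \<open>lact_adjoint\<close> says that
  the adjoint of the action of \<open>a\<close> is the action of \<open>star a\<close>. It need not be unital.
\<close>

locale correspondence = hilbert_module M for M :: "('x, 'a::unital_cstar_algebra, 'z) corr_scheme" +
  assumes lact_closed: "x \<in> hcar M \<Longrightarrow> lact M a x \<in> hcar M"
    and lact_add_right: "\<lbrakk>x \<in> hcar M; y \<in> hcar M\<rbrakk>
          \<Longrightarrow> lact M a (hadd M x y) = hadd M (lact M a x) (lact M a y)"
    and lact_ract: "x \<in> hcar M \<Longrightarrow> lact M a (ract M x b) = ract M (lact M a x) b"
    and lact_adjoint: "\<lbrakk>x \<in> hcar M; y \<in> hcar M\<rbrakk>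
          \<Longrightarrow> ip M (lact M a x) y = ip M x (lact M (star a) y)"
    and lact_add_left: "x \<in> hcar M \<Longrightarrow> lact M (a + b) x = hadd M (lact M a x) (lact M b x)"
    and lact_scaleC: "x \<in> hcar M \<Longrightarrow> lact M (scaleC c a) x = ract M (lact M a x) (scaleC c 1)"
    and lact_mult: "x \<in> hcar M \<Longrightarrow> lact M (a * b) x = lact M a (lact M b x)"

definition essential :: "('x, 'a::unital_cstar_algebra, 'z) corr_scheme \<Rightarrow> bool" where
  "essential M \<longleftrightarrow> (\<forall>n\<in>hcar M. lact M 1 n = n)"

definition corr_iso ::
  "('x, 'a, 'z) corr_scheme \<Rightarrow> ('y, 'a, 'w) corr_scheme \<Rightarrow> ('x \<Rightarrow> 'y) \<Rightarrow> bool" where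
  "corr_iso M N f \<longleftrightarrow> hmod_iso M N f \<and> (\<forall>a. \<forall>x\<in>hcar M. f (lact M a x) = lact N a (f x))"

definition trivial_corr :: "('a::unital_cstar_algebra, 'a) corr" where
  "trivial_corr = \<lparr>hcar = UNIV, hadd = (+), hzero = 0, ract = (*), ip = (\<lambda>a b. star a * b), lact = (*)\<rparr>"

text \<open>
  The internal tensor product is the completion of the algebraic balanced tensor product, modulo
  the vectors of length zero, in the inner product
  \<open>\<langle>y \<otimes> n, y' \<otimes> n'\<rangle> = \<langle>n, \<langle>y, y'\<rangle> \<cdot> n'\<rangle>\<close>. \<open>internal_tensor Y N T t\<close> says that the Hilbert module \<open>T\<close>
  is such a completion, with elementary tensors \<open>t y n\<close>; this determines \<open>(T, t)\<close> up to a unique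
  isomorphism.
\<close>

definition internal_tensor ::
  "('y, 'a::unital_cstar_algebra, 'z) hmod_scheme \<Rightarrow> ('n, 'a, 'w) corr_scheme \<Rightarrow>
   ('t, 'a, 'v) hmod_scheme \<Rightarrow> ('y \<Rightarrow> 'n \<Rightarrow> 't) \<Rightarrow> bool" where
  "internal_tensor Y N T t \<longleftrightarrow>
     hilbert_module Y \<and> correspondence N \<and> hilbert_module T \<and>
     (\<forall>y\<in>hcar Y. \<forall>n\<in>hcar N. t y n \<in> hcar T) \<and>
     (\<forall>y\<in>hcar Y. \<forall>y'\<in>hcar Y. \<forall>n\<in>hcar N. t (hadd Y y y') n = hadd T (t y n) (t y' n)) \<and>
     (\<forall>y\<in>hcar Y. \<forall>n\<in>hcar N. \<forall>n'\<in>hcar N. t y (hadd N n n') = hadd T (t y n) (t y n')) \<and>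
     (\<forall>y\<in>hcar Y. \<forall>n\<in>hcar N. \<forall>a. t (ract Y y a) n = t y (lact N a n)) \<and>
     (\<forall>y\<in>hcar Y. \<forall>n\<in>hcar N. \<forall>a. t y (ract N n a) = ract T (t y n) a) \<and>
     (\<forall>y\<in>hcar Y. \<forall>y'\<in>hcar Y. \<forall>n\<in>hcar N. \<forall>n'\<in>hcar N.
        ip T (t y n) (t y' n') = ip N n (lact N (ip Y y y') n')) \<and>
     hdense T (hspan T {t y n | y n. y \<in> hcar Y \<and> n \<in> hcar N})"

definition corr_tensor ::
  "('y, 'a::unital_cstar_algebra, 'z) corr_scheme \<Rightarrow> ('n, 'a, 'w) corr_scheme \<Rightarrow>
   ('t, 'a, 'v) corr_scheme \<Rightarrow> ('y \<Rightarrow> 'n \<Rightarrow> 't) \<Rightarrow> bool" where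
  "corr_tensor Y N T t \<longleftrightarrow>
     correspondence Y \<and> correspondence T \<and> internal_tensor Y N T t \<and>
     (\<forall>y\<in>hcar Y. \<forall>n\<in>hcar N. \<forall>a. lact T a (t y n) = t (lact Y a y) n)"

text \<open>
  \<open>tensor_id Y N T t T' t' S\<close> is the map \<open>S \<otimes> id\<close> from \<open>T = Y \<otimes> N\<close> to \<open>T' = Y' \<otimes> N\<close>, for
  inner-product preserving \<open>S: Y \<rightarrow> Y'\<close>. Such a map exists, and it is unique on the carrier of
  \<open>T\<close>, since it is isometric and the elementary tensors span a dense submodule.
\<close>

definition tensor_id ::
  "('y, 'a, 'z1) hmod_scheme \<Rightarrow> ('n, 'a, 'z2) hmod_scheme \<Rightarrow>
   ('t, 'a, 'z3) hmod_scheme \<Rightarrow> ('y \<Rightarrow> 'n \<Rightarrow> 't) \<Rightarrow>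
   ('s, 'a, 'z4) hmod_scheme \<Rightarrow> ('w \<Rightarrow> 'n \<Rightarrow> 's) \<Rightarrow> ('y \<Rightarrow> 'w) \<Rightarrow> 't \<Rightarrow> 's" where
  "tensor_id Y N T t T' t' S =
     (SOME f. ip_preserving T T' f \<and> (\<forall>y\<in>hcar Y. \<forall>n\<in>hcar N. f (t y n) = t' (S y) n))"

text \<open>
  The tensor powers of \<open>M\<close>: \<open>P k\<close> is the \<open>k\<close>-th power; \<open>u\<close> identifies \<open>A\<close> with \<open>P 0\<close> and
  \<open>v\<close> identifies \<open>M\<close> with \<open>P 1\<close>; \<open>\<tau> i j\<close> is the tensor product of elements of \<open>P i\<close> and \<open>P j\<close>.
  The last three conditions are the usual identifications: associativity,
  \<open>A \<otimes> P k = P k\<close> via \<open>a \<otimes> p \<mapsto> a \<cdot> p\<close>, and \<open>P k \<otimes> A = P k\<close> via \<open>p \<otimes> a \<mapsto> p \<cdot> a\<close>.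
\<close>

definition tensor_powers ::
  "('m, 'a::unital_cstar_algebra) corr \<Rightarrow> (nat \<Rightarrow> ('t, 'a) corr) \<Rightarrow> ('a \<Rightarrow> 't) \<Rightarrow> ('m \<Rightarrow> 't) \<Rightarrow>
   (nat \<Rightarrow> nat \<Rightarrow> 't \<Rightarrow> 't \<Rightarrow> 't) \<Rightarrow> bool" where
  "tensor_powers M P u v \<tau> \<longleftrightarrow>
     corr_iso trivial_corr (P 0) u \<and>
     corr_iso M (P 1) v \<and>
     (\<forall>i j. corr_tensor (P i) (P j) (P (i + j)) (\<tau> i j)) \<and>
     (\<forall>i j k. \<forall>p\<in>hcar (P i). \<forall>q\<in>hcar (P j). \<forall>r\<in>hcar (P k).
        \<tau> (i + j) k (\<tau> i j p q) r = \<tau> i (j + k) p (\<tau> j k q r)) \<and>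
     (\<forall>k a. \<forall>p\<in>hcar (P k). \<tau> 0 k (u a) p = lact (P k) a p) \<and>
     (\<forall>k a. \<forall>p\<in>hcar (P k). \<tau> k 0 p (u a) = ract (P k) p a)"

fun elementary_tensor ::
  "('a::unital_cstar_algebra \<Rightarrow> 't) \<Rightarrow> ('m \<Rightarrow> 't) \<Rightarrow> (nat \<Rightarrow> nat \<Rightarrow> 't \<Rightarrow> 't \<Rightarrow> 't) \<Rightarrow> 'm list \<Rightarrow> 't" where
  "elementary_tensor u v \<tau> [] = u 1"
| "elementary_tensor u v \<tau> (n # ns) = \<tau> 1 (length ns) (v n) (elementary_tensor u v \<tau> ns)"

text \<open>
  \<open>W k\<close> is \<open>X \<otimes> M\<^bsup>\<otimes>k\<^esup>\<close>, with elementary tensors \<open>\<sigma> k x p\<close>. The map \<open>\<rho> k\<close> is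
  the tensor product of elements of \<open>X \<otimes> M\<close> and \<open>M\<^bsup>\<otimes>k\<^esup>\<close> under the identification of
  \<open>(X \<otimes> M) \<otimes> M\<^bsup>\<otimes>k\<^esup>\<close> with \<open>X \<otimes> M\<^bsup>\<otimes>(k+1)\<^esup>\<close>.
\<close>

definition tensor_with_powers ::
  "('x, 'a::unital_cstar_algebra) hmod \<Rightarrow> (nat \<Rightarrow> ('t, 'a) corr) \<Rightarrow>
   (nat \<Rightarrow> nat \<Rightarrow> 't \<Rightarrow> 't \<Rightarrow> 't) \<Rightarrow>
   (nat \<Rightarrow> ('w, 'a) hmod) \<Rightarrow> (nat \<Rightarrow> 'x \<Rightarrow> 't \<Rightarrow> 'w) \<Rightarrow> (nat \<Rightarrow> 'w \<Rightarrow> 't \<Rightarrow> 'w) \<Rightarrow> bool" where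
  "tensor_with_powers X P \<tau> W \<sigma> \<rho> \<longleftrightarrow>
     (\<forall>k. internal_tensor X (P k) (W k) (\<sigma> k)) \<and>
     (\<forall>k. internal_tensor (W 1) (P k) (W (Suc k)) (\<rho> k)) \<and>
     (\<forall>k. \<forall>x\<in>hcar X. \<forall>p\<in>hcar (P 1). \<forall>q\<in>hcar (P k).
        \<rho> k (\<sigma> 1 x p) q = \<sigma> (Suc k) x (\<tau> 1 k p q))"

text \<open>\<open>XM\<close> is \<open>X \<otimes> M\<close>, with elementary tensors \<open>t x n\<close>.\<close>

definition scaling_function ::
  "('m, 'a::unital_cstar_algebra) corr \<Rightarrow> 'm \<Rightarrow> ('w, 'a) hmod \<Rightarrow> ('x \<Rightarrow> 'm \<Rightarrow> 'w) \<Rightarrow>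
   ('x, 'a) hmod \<Rightarrow> ('x \<Rightarrow> 'w) \<Rightarrow> 'x \<Rightarrow> bool" where
  "scaling_function M m0 XM t X D \<phi> \<longleftrightarrow>
     hilbert_module X \<and> internal_tensor X M XM t \<and> hmod_iso X XM D \<and>
     \<phi> \<in> hcar X \<and> ip X \<phi> \<phi> = 1 \<and> D \<phi> = t \<phi> m0"

text \<open>
  The powers \<open>D\<^sup>k: X \<rightarrow> X \<otimes> M\<^bsup>\<otimes>k\<^esup>\<close>, in the notation of \<open>tensor_with_powers\<close>. The
  identity \<open>D\<^sup>0\<close> appears as the identification \<open>x \<mapsto> x \<otimes> 1\<close> of \<open>X\<close> with \<open>X \<otimes> A\<close>.
\<close>

fun dilation_power ::
  "('x, 'a::unital_cstar_algebra) hmod \<Rightarrow> (nat \<Rightarrow> ('t, 'a) corr) \<Rightarrow> ('a \<Rightarrow> 't) \<Rightarrow>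
   (nat \<Rightarrow> ('w, 'a) hmod) \<Rightarrow> (nat \<Rightarrow> 'x \<Rightarrow> 't \<Rightarrow> 'w) \<Rightarrow> (nat \<Rightarrow> 'w \<Rightarrow> 't \<Rightarrow> 'w) \<Rightarrow>
   ('x \<Rightarrow> 'w) \<Rightarrow> nat \<Rightarrow> 'x \<Rightarrow> 'w" where
  "dilation_power X P u W \<sigma> \<rho> D 0 = (\<lambda>x. \<sigma> 0 x (u 1))"
| "dilation_power X P u W \<sigma> \<rho> D (Suc 0) = D"
| "dilation_power X P u W \<sigma> \<rho> D (Suc (Suc k)) =
     tensor_id X (P (Suc k)) (W (Suc k)) (\<sigma> (Suc k)) (W (Suc (Suc k))) (\<rho> (Suc k)) D
       \<circ> dilation_power X P u W \<sigma> \<rho> D (Suc k)"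

text \<open>
  \<open>L\<close> is a completion of the union of the isometrically embedded \<open>X k\<close>, where
  \<open>x\<close> in \<open>X k\<close> is identified with \<open>T k x\<close> in \<open>X (k+1)\<close>; again this determines \<open>(L, \<iota>)\<close> up to a
  unique isomorphism.
\<close>

definition direct_limit ::
  "(nat \<Rightarrow> ('x, 'a::unital_cstar_algebra, 'z) hmod_scheme) \<Rightarrow> (nat \<Rightarrow> 'x \<Rightarrow> 'x) \<Rightarrow>
   ('l, 'a, 'w) hmod_scheme \<Rightarrow> (nat \<Rightarrow> 'x \<Rightarrow> 'l) \<Rightarrow> bool" where
  "direct_limit X T L \<iota> \<longleftrightarrow>
     (\<forall>k. hilbert_module (X k) \<and> ip_preserving (X k) (X (Suc k)) (T k)) \<and>
     hilbert_module L \<and>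
     (\<forall>k. ip_preserving (X k) L (\<iota> k)) \<and>
     (\<forall>k. \<forall>x\<in>hcar (X k). \<iota> (Suc k) (T k x) = \<iota> k x) \<and>
     hdense L (\<Union>k. \<iota> k ` hcar (X k))"

text \<open>
  Tuples \<open>(j\<^sub>1, \<dots>, j\<^sub>k)\<close> are lists; the empty list is the index of the extra element \<open>\<phi>\<close>.
\<close>

definition frame_index :: "nat set \<Rightarrow> nat list set" where
  "frame_index J = {[]} \<union> {js. js \<noteq> [] \<and> set js \<subseteq> J \<and> hd js > 0}"

definition frame_element ::
  "('x, 'a::unital_cstar_algebra) hmod \<Rightarrow> (nat \<Rightarrow> ('t, 'a) corr) \<Rightarrow> ('a \<Rightarrow> 't) \<Rightarrow> ('m \<Rightarrow> 't) \<Rightarrow>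
   (nat \<Rightarrow> nat \<Rightarrow> 't \<Rightarrow> 't \<Rightarrow> 't) \<Rightarrow>
   (nat \<Rightarrow> ('w, 'a) hmod) \<Rightarrow> (nat \<Rightarrow> 'x \<Rightarrow> 't \<Rightarrow> 'w) \<Rightarrow> (nat \<Rightarrow> 'w \<Rightarrow> 't \<Rightarrow> 'w) \<Rightarrow>
   ('x \<Rightarrow> 'w) \<Rightarrow> 'x \<Rightarrow> (nat \<Rightarrow> 'm) \<Rightarrow> nat list \<Rightarrow> 'x" where
  "frame_element X P u v \<tau> W \<sigma> \<rho> D \<phi> m js =
     (if js = [] then \<phi>
      else inv_into (hcar X) (dilation_power X P u W \<sigma> \<rho> D (length js))
             (\<sigma> (length js) \<phi> (elementary_tensor u v \<tau> (map m js))))"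

end

theory Submission
  imports Defs
begin

text \<open>
  The map \<open>E k p = Q (\<iota> k p)\<close> is isometric from \<open>M\<^bsup>\<otimes>k\<^esup>\<close> to \<open>X\<close>, satisfies
  \<open>D\<^sup>k (E k p) = \<phi> \<otimes> p\<close> and \<open>E (k + 1) (m\<^sub>0 \<otimes> p) = E k p\<close>. Hence the displayed elements with at most
  \<open>k\<close> factors are, after padding the index with zeros on the left, the images under \<open>E k\<close> of
  all elementary tensors of length \<open>k\<close> in the frame elements of \<open>M\<close>. Those tensors form a
  Parseval frame of \<open>M\<^bsup>\<otimes>k\<^esup>\<close>, and the Parseval identity extends from the dense
  union of the ranges of the \<open>E k\<close> to its closure \<open>Q(M\<^sub>\<infinity>)\<close>. Double series and limits of partial
  sums are controlled by the order of the \<open>C\<^sup>*\<close>-algebra, which rests on \<open>star b * b\<close> having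
  nonnegative spectrum.
\<close>

section \<open>Positivity in unital C*-algebras\<close>

text \<open>The obstacle is that the index set grows with \<open>k\<close>: no frame of a single
  tensor power survives in the limit. This is why a sum of positive terms is described by two
  independent statements: every finite partial sum lies below the total, and some finite partial sum
  is close to it. The first is tested at a level above all tuples of the finite set, the second at
  the level \<open>k\<close> of \<open>x\<close>. The same splitting treats product index sets and
  the passage to the closure. It asks three things of the order: sums and norm limits of positive
  elements are positive, and the norm is monotone on them. These come from square roots built by an
  iteration; the clause that a root of \<open>a\<close> commutes with everything commuting with
  \<open>a\<close> does the work of functional calculus.\<close>

lemma norm_star: "norm (star a) = norm (a::'a::unital_cstar_algebra)"
proof -
  have *: "norm b \<le> norm (star b)" for b :: 'a
  proof (cases "norm b = 0")
    case False
    have "norm b * norm b \<le> norm (star b) * norm b"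
      using norm_mult_ineq[of "star b" b] by (simp add: cstar_identity power2_eq_square)
    then show ?thesis using False by simp
  qed simp
  show ?thesis using *[of a] *[of "star a"] by (simp add: star_star)
qed

lemma norm_mult_star_self: "norm (a * star a) = (norm (a::'a::unital_cstar_algebra))\<^sup>2"
  using cstar_identity[of "star a"] by (simp add: star_star norm_star)

lemma star_scaleR: "star (r *\<^sub>R a) = r *\<^sub>R star (a::'a::unital_cstar_algebra)"
  using star_scaleC[of "complex_of_real r" a] by (simp add: scaleC_of_real)

lemma bounded_linear_star: "bounded_linear (star :: 'a::unital_cstar_algebra \<Rightarrow> 'a)"
  by (rule bounded_linear_intro[where K=1]) (simp_all add: star_add star_scaleR norm_star)

lemmas star_zero = linear_0[OF bounded_linear.linear[OF bounded_linear_star]]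
lemmas star_minus = linear_neg[OF bounded_linear.linear[OF bounded_linear_star]]
lemmas star_diff = linear_diff[OF bounded_linear.linear[OF bounded_linear_star]]
lemmas tendsto_star = bounded_linear.tendsto[OF bounded_linear_star]

lemma star_one: "star 1 = (1::'a::unital_cstar_algebra)"
  by (metis mult.right_neutral mult.left_neutral star_mult star_star)

text \<open>By the C*-identity \<open>norm 1\<close> equals its own square. The value 0 occurs in
  the zero algebra, which the class admits; hence an inequality.\<close>

lemma norm_one_le: "norm (1::'a::unital_cstar_algebra) \<le> 1"
  using cstar_identity[of "1::'a"] by (cases "norm (1::'a) = 0") (simp_all add: star_one power2_eq_square)

lemma bounded_linear_scaleC: "bounded_linear (scaleC c :: 'a::unital_cstar_algebra \<Rightarrow> 'a)"
proof (rule bounded_linear_intro[where K="cmod c"])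
  show "scaleC c (r *\<^sub>R a) = r *\<^sub>R scaleC c a" for r and a :: 'a
    by (metis scaleC_of_real scaleC_scaleC mult.commute)
qed (simp_all add: scaleC_add_right norm_scaleC mult.commute)

lemmas scaleC_diff_right = linear_diff[OF bounded_linear.linear[OF bounded_linear_scaleC]]
lemmas scaleC_minus_right = linear_neg[OF bounded_linear.linear[OF bounded_linear_scaleC]]
lemmas scaleC_scaleR = linear_scale[OF bounded_linear.linear[OF bounded_linear_scaleC]]

lemma scaleC_minus_one: "scaleC (- 1) a = - (a::'a::unital_cstar_algebra)"
  using scaleC_of_real[of "-1" a] by simp

lemma scaleC_i_i: "scaleC \<i> (scaleC \<i> a) = - (a::'a::unital_cstar_algebra)"
  by (simp add: scaleC_scaleC scaleC_minus_one)

lemma scaleC_minus_left: "scaleC (- c) a = - scaleC c (a::'a::unital_cstar_algebra)"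
  using scaleC_scaleC[of "-1" c a] by (simp add: scaleC_minus_one)

lemma star_scaleC_i: "star (scaleC \<i> a) = - scaleC \<i> (star (a::'a::unital_cstar_algebra))"
  by (simp add: star_scaleC scaleC_minus_left)

text \<open>
  The square root is \<open>1 - y\<close> for the limit \<open>y\<close> of the iteration \<open>y \<mapsto> (h + y * y) / 2\<close>, which is
  dominated by the same iteration for the number \<open>1\<close>.
\<close>

lemma sqrt_one_minus:
  fixes h :: "'a::unital_cstar_algebra"
  assumes h: "star h = h" "norm h \<le> 1"
  shows "\<exists>s. star s = s \<and> s * s = 1 - h \<and> norm (1 - s) \<le> 1 \<and> (\<forall>c. c * h = h * c \<longrightarrow> c * s = s * c)"
proof -
  define y where "y n = rec_nat 0 (\<lambda>_ y. (1/2) *\<^sub>R (h + y * y)) n" for n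
  have y0: "y 0 = 0" and ySuc: "y (Suc n) = (1/2) *\<^sub>R (h + y n * y n)" for n
    by (simp_all add: y_def)
  define z :: "nat \<Rightarrow> real" where "z n = rec_nat 0 (\<lambda>_ y. (1 + y * y) / 2) n" for n
  have z0: "z 0 = 0" and zSuc: "z (Suc n) = (1 + z n * z n) / 2" for n
    by (simp_all add: z_def)
  have z_bound: "0 \<le> z n \<and> z n \<le> 1" for n
    by (induction n) (auto simp: z0 zSuc mult_le_one)
  have y_le: "norm (y n) \<le> z n" for n
  proof (induction n)
    case (Suc n)
    have "norm (y n * y n) \<le> z n * z n"
      by (rule order_trans[OF norm_mult_ineq]) (intro mult_mono Suc norm_ge_zero, use z_bound in auto)
    then show ?case
      using norm_triangle_ineq[of h "y n * y n"] h by (simp add: ySuc zSuc)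
  qed (simp add: y0 z0)
  have diff: "norm (y (Suc n) - y n) \<le> z (Suc n) - z n" for n
  proof (induction n)
    case (Suc n)
    let ?d = "y (Suc n) - y n"
    have eq: "y (Suc (Suc n)) - y (Suc n) = (1/2) *\<^sub>R (y (Suc n) * ?d + ?d * y n)"
      by (simp add: ySuc[of "Suc n"] ySuc[of n] scaleR_diff_right[symmetric] del: scaleR_diff_right)
         (simp add: ySuc[of n, symmetric] algebra_simps)
    have "norm (y (Suc n) * ?d) \<le> z (Suc n) * (z (Suc n) - z n)"
      by (rule order_trans[OF norm_mult_ineq]) (intro mult_mono Suc norm_ge_zero y_le, use z_bound in auto)
    moreover have "norm (?d * y n) \<le> (z (Suc n) - z n) * z n"
      by (rule order_trans[OF norm_mult_ineq], intro mult_mono Suc norm_ge_zero y_le)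
         (use Suc norm_ge_zero order_trans in blast)
    moreover have "z (Suc (Suc n)) - z (Suc n)
        = (1/2) * (z (Suc n) * (z (Suc n) - z n) + (z (Suc n) - z n) * z n)"
      by (simp add: zSuc[of "Suc n"] field_simps) (simp add: zSuc[of n] field_simps)
    ultimately show ?case
      using norm_triangle_ineq[of "y (Suc n) * ?d" "?d * y n"] by (simp only: eq norm_scaleR) simp
  qed (use h in \<open>simp add: y0 z0 ySuc zSuc\<close>)
  \<comment> \<open>The increments of \<open>z\<close> dominate norms, so \<open>z\<close>
    increases; it is bounded by 1, so its increments telescope to a convergent series, a majorant
    for the increments of \<open>y\<close>.\<close>
  have "incseq z"
  proof (rule incseq_SucI)
    show "z n \<le> z (Suc n)" for n
      using diff[of n] norm_ge_zero[of "y (Suc n) - y n"] by linarith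
  qed
  moreover have "bdd_above (range z)" using z_bound by (auto intro!: bdd_aboveI[where M=1])
  ultimately have "convergent z"
    using LIMSEQ_incseq_SUP convergent_def by blast
  then have "summable (\<lambda>n. z (Suc n) - z n)"
    unfolding convergent_def using telescope_summable by blast
  then have "summable (\<lambda>n. y (Suc n) - y n)"
    by (rule summable_comparison_test') (rule diff)
  then obtain l where "(\<lambda>n. \<Sum>i<n. y (Suc i) - y i) \<longlonglongrightarrow> l"
    unfolding summable_def sums_def by blast
  then have lim: "y \<longlonglongrightarrow> l"
    by (simp add: sum_lessThan_telescope y0)
  have "(\<lambda>n. y (Suc n)) \<longlonglongrightarrow> (1/2) *\<^sub>R (h + l * l)"
    unfolding ySuc by (intro tendsto_intros lim)
  then have l: "l = (1/2) *\<^sub>R (h + l * l)"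
    using LIMSEQ_unique LIMSEQ_Suc[OF lim] by blast
  then have l2: "l + l = h + l * l"
    by (metis scaleR_2 scaleR_half_double scaleR_left_distrib field_sum_of_halves scaleR_one scaleR_add_right)
  have comm: "c * l = l * c" if "c * h = h * c" for c
  proof -
    have cy: "c * y n = y n * c" for n
    proof (induction n)
      case (Suc n)
      have "c * (y n * y n) = y n * y n * c" by (metis Suc mult.assoc)
      then show ?case by (simp add: ySuc distrib_left distrib_right that)
    qed (simp add: y0)
    have "(\<lambda>n. c * y n) \<longlonglongrightarrow> c * l" by (intro tendsto_intros lim)
    moreover have "(\<lambda>n. c * y n) \<longlonglongrightarrow> l * c" unfolding cy by (intro tendsto_intros lim)
    ultimately show ?thesis by (rule LIMSEQ_unique)
  qed
  have "star (y n) = y n" for n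
    by (induction n) (simp_all add: y0 ySuc star_zero star_scaleR star_add star_mult h)
  then have sl: "star l = l"
    using LIMSEQ_unique[OF tendsto_star[OF lim]] lim by simp
  have nl: "norm l \<le> 1"
    by (rule LIMSEQ_le_const2[OF tendsto_norm[OF lim]])
       (use y_le z_bound order_trans in blast)
  have "(1 - l) * (1 - l) = 1 - h"
  proof -
    have "(1 - l) * (1 - l) = 1 - (l + l) + l * l" by (simp add: algebra_simps)
    then show ?thesis by (simp add: l2)
  qed
  moreover have "\<forall>c. c * h = h * c \<longrightarrow> c * (1 - l) = (1 - l) * c"
    by (intro allI impI, drule comm) (simp add: algebra_simps)
  moreover have "star (1 - l) = 1 - l" "norm (1 - (1 - l)) \<le> 1"
    using sl nl by (simp_all add: star_diff star_one)
  ultimately show ?thesis by blast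
qed

text \<open>
  A norm description of positivity, for which closure under addition is evident. That it agrees
  with \<open>positive\<close> is the theorem of Fukamiya and Kaplansky.
\<close>

definition norm_positive :: "'a::unital_cstar_algebra \<Rightarrow> bool" where
  "norm_positive a \<longleftrightarrow> star a = a \<and> (\<exists>t\<ge>0. norm (t *\<^sub>R 1 - a) \<le> t)"

lemma norm_positive_zero: "norm_positive 0"
  unfolding norm_positive_def by (auto simp: star_zero intro!: exI[of _ 0])

lemma norm_positive_add: "norm_positive a \<Longrightarrow> norm_positive b \<Longrightarrow> norm_positive (a + b)"
  unfolding norm_positive_def
proof (safe, goal_cases)
  case (2 t s)
  have "(t + s) *\<^sub>R 1 - (a + b) = (t *\<^sub>R 1 - a) + (s *\<^sub>R 1 - b)" by (simp add: algebra_simps)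
  then have "norm ((t + s) *\<^sub>R 1 - (a + b)) \<le> t + s"
    using 2 by (metis norm_triangle_ineq add_mono order_trans)
  then show ?case using 2 by (intro exI[of _ "t + s"]) auto
qed (simp add: star_add)

lemma norm_positive_scaleR:
  assumes "norm_positive a" "0 \<le> r" shows "norm_positive (r *\<^sub>R a)"
proof -
  obtain t where t: "t \<ge> 0" "norm (t *\<^sub>R 1 - a) \<le> t" "star a = a"
    using assms unfolding norm_positive_def by blast
  have "(r * t) *\<^sub>R 1 - r *\<^sub>R a = r *\<^sub>R (t *\<^sub>R 1 - a)" by (simp add: algebra_simps)
  then have "norm ((r * t) *\<^sub>R 1 - r *\<^sub>R a) \<le> r * t"
    using t assms(2) by (simp add: mult_left_mono)
  then show ?thesis
    unfolding norm_positive_def using t assms(2) by (auto simp: star_scaleR intro!: exI[of _ "r * t"])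
qed

lemma norm_positive_norm_diff: "star a = a \<Longrightarrow> norm_positive (norm a *\<^sub>R 1 - a)"
  unfolding norm_positive_def
  by (auto simp: star_diff star_scaleR star_one intro!: exI[of _ "norm a"])

text \<open>Dividing by the \<open>t\<close> of the definition turns \<open>a\<close> into
  \<open>1 - h\<close> with \<open>norm h \<le> 1\<close>. The bound
  \<open>norm (1 - s) \<le> 1\<close> supplied by \<open>sqrt_one_minus\<close> is the positivity
  test for the root, with \<open>t = 1\<close>.\<close>

lemma norm_positive_sqrt:
  fixes a :: "'a::unital_cstar_algebra"
  assumes "norm_positive a"
  shows "\<exists>q. norm_positive q \<and> star q = q \<and> q * q = a \<and> (\<forall>c. c * a = a * c \<longrightarrow> c * q = q * c)"
proof -
  obtain t where t: "t \<ge> 0" "norm (t *\<^sub>R 1 - a) \<le> t" "star a = a"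
    using assms unfolding norm_positive_def by blast
  show ?thesis
  proof (cases "t = 0")
    case True
    then have "a = 0" using t by simp
    then show ?thesis using norm_positive_zero by (intro exI[of _ 0]) (simp add: star_zero)
  next
    case False
    with t have tp: "t > 0" by simp
    define h where "h = 1 - (1 / t) *\<^sub>R a"
    have th: "t *\<^sub>R h = t *\<^sub>R 1 - a" using tp by (simp add: h_def algebra_simps)
    have "t * norm h \<le> t" using t(2) tp unfolding th[symmetric] by simp
    then have "norm h \<le> 1" using tp by simp
    moreover have "star h = h" by (simp add: h_def star_diff star_one star_scaleR t)
    ultimately obtain s where s: "star s = s" "s * s = 1 - h" "norm (1 - s) \<le> 1"
        "\<And>c. c * h = h * c \<Longrightarrow> c * s = s * c"
      using sqrt_one_minus by blast
    have ps: "norm_positive s"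
      unfolding norm_positive_def using s(1,3) by (auto intro!: exI[of _ 1])
    have "norm_positive (sqrt t *\<^sub>R s)" using norm_positive_scaleR[OF ps] tp by simp
    moreover have "(sqrt t *\<^sub>R s) * (sqrt t *\<^sub>R s) = a" using tp s(2) by (simp add: h_def)
    moreover have "c * (sqrt t *\<^sub>R s) = sqrt t *\<^sub>R s * c" if "c * a = a * c" for c
      using s(4)[of c] that by (simp add: h_def algebra_simps)
    ultimately show ?thesis using s(1) by (intro exI[of _ "sqrt t *\<^sub>R s"]) (simp add: star_scaleR)
  qed
qed

text \<open>The element \<open>w = g + i s\<close> satisfies
  \<open>star w * w = g * g + s * s\<close> because \<open>g\<close> and \<open>s\<close> commute,
  so the C*-identity bounds \<open>norm w\<close>; and \<open>g\<close> is the real part of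
  \<open>w\<close>.\<close>

lemma norm_le_of_commuting_squares:
  fixes g s :: "'a::unital_cstar_algebra"
  assumes sa: "star g = g" "star s = s" and comm: "g * s = s * g"
    and sum: "g * g + s * s = t *\<^sub>R 1" and t: "t \<ge> 0"
  shows "norm (g * g) \<le> t"
proof -
  define w where "w = g + scaleC \<i> s"
  have sw: "star w = g - scaleC \<i> s" by (simp add: w_def star_add star_scaleC_i sa)
  have "star w * w = t *\<^sub>R 1"
    unfolding sw unfolding w_def sum[symmetric]
    by (simp add: algebra_simps mult_scaleC_left mult_scaleC_right scaleC_i_i scaleC_diff_right comm)
  then have "(norm w)\<^sup>2 \<le> t"
    using cstar_identity[of w] mult_left_le[OF norm_one_le[where 'a='a] t] t by simp
  moreover have "2 *\<^sub>R g = w + star w" unfolding sw unfolding w_def by (simp add: scaleR_2)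
  then have "2 * norm g \<le> 2 * norm w"
    using norm_triangle_ineq[of w "star w"] by (metis norm_scaleR norm_star mult_2 abs_numeral)
  then have "(norm g)\<^sup>2 \<le> (norm w)\<^sup>2" by (simp add: power_mono)
  moreover have "norm (g * g) \<le> (norm g)\<^sup>2" by (simp add: power2_eq_square norm_mult_ineq)
  ultimately show ?thesis by linarith
qed

text \<open>After scaling to norm 1, \<open>1 - g * g\<close> has a root \<open>s\<close> commuting
  with \<open>g\<close>, and \<open>s * s + g * g = 1\<close> forces
  \<open>norm (1 - g * g) \<le> 1\<close>, the positivity test with \<open>t = 1\<close>.\<close>

lemma norm_positive_square:
  fixes h :: "'a::unital_cstar_algebra"
  assumes h: "star h = h" shows "norm_positive (h * h)"
proof (cases "h = 0")
  case False
  define g where "g = (1 / norm h) *\<^sub>R h"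
  have g: "star g = g" "norm g = 1" using False by (simp_all add: g_def star_scaleR h)
  have "norm (g * g) \<le> 1" using norm_mult_ineq[of g g] g by simp
  moreover have "star (g * g) = g * g" by (simp add: star_mult g)
  ultimately obtain s where s: "star s = s" "s * s = 1 - g * g"
      "\<And>c. c * (g * g) = (g * g) * c \<Longrightarrow> c * s = s * c"
    using sqrt_one_minus[of "g * g"] by blast
  have "norm (s * s) \<le> 1"
    by (rule norm_le_of_commuting_squares[of s g]) (use s g s(3)[of g] in \<open>auto simp: mult.assoc\<close>)
  then have "norm_positive (g * g)"
    unfolding norm_positive_def using s(2) g(1) by (auto simp: star_mult intro!: exI[of _ 1])
  then have "norm_positive ((norm h)\<^sup>2 *\<^sub>R (g * g))" by (rule norm_positive_scaleR) simp
  then show ?thesis using False by (simp add: g_def power2_eq_square)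
qed (simp add: norm_positive_zero)

text \<open>The commutation clauses make the roots of \<open>a\<close> and of
  \<open>t *\<^sub>R 1 - a\<close> commute, and their squares add up to
  \<open>t *\<^sub>R 1\<close>.\<close>

lemma norm_positive_norm_le:
  fixes a :: "'a::unital_cstar_algebra"
  assumes "norm_positive a" "norm_positive (t *\<^sub>R 1 - a)" "t \<ge> 0"
  shows "norm a \<le> t"
proof -
  obtain g where g: "star g = g" "g * g = a" "\<And>c. c * a = a * c \<Longrightarrow> c * g = g * c"
    using norm_positive_sqrt[OF assms(1)] by blast
  obtain k where k: "star k = k" "k * k = t *\<^sub>R 1 - a"
      "\<And>c. c * (t *\<^sub>R 1 - a) = (t *\<^sub>R 1 - a) * c \<Longrightarrow> c * k = k * c"
    using norm_positive_sqrt[OF assms(2)] by blast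
  have "g * a = a * g" using g(2) by (metis mult.assoc)
  then have "g * k = k * g" by (intro k(3)) (simp add: algebra_simps)
  then show ?thesis
    using norm_le_of_commuting_squares[OF g(1) k(1)] g(2) k(2) assms(3) by simp
qed

lemma norm_positive_mono:
  fixes a :: "'a::unital_cstar_algebra"
  assumes "norm_positive a" "norm_positive b"
  shows "norm a \<le> norm (a + b)"
proof (rule norm_positive_norm_le[OF assms(1)])
  have "norm_positive ((norm (a + b) *\<^sub>R 1 - (a + b)) + b)"
    by (intro norm_positive_add norm_positive_norm_diff assms(2))
       (use norm_positive_add[OF assms] in \<open>simp add: norm_positive_def\<close>)
  then show "norm_positive (norm (a + b) *\<^sub>R 1 - a)" by simp
qed simp

text \<open>A root \<open>s\<close> of \<open>p\<close> commutes with \<open>h\<close>, so the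
  product is the square of the self-adjoint element \<open>s * h\<close>.\<close>

lemma norm_positive_commuting_mult:
  fixes p h :: "'a::unital_cstar_algebra"
  assumes "norm_positive p" "star h = h" "h * p = p * h"
  shows "norm_positive (h * h * p)"
proof -
  obtain s where s: "star s = s" "s * s = p" "h * s = s * h"
    using norm_positive_sqrt[OF assms(1)] assms(3) by metis
  have "norm_positive ((s * h) * (s * h))"
    by (rule norm_positive_square) (simp add: star_mult s assms(2))
  moreover have "(s * h) * (s * h) = h * h * p"
    by (metis s(2,3) mult.assoc)
  ultimately show ?thesis by simp
qed


text \<open>
  Since \<open>x * star x\<close> is positive, \<open>star x * z ^ n * x\<close> with \<open>z = 1 - x * star x / t\<close>
  stays bounded. It equals \<open>- (1 + c) ^ n * (k * k)\<close> with \<open>c = k * k / t\<close>, which grows linearly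
  unless \<open>k = 0\<close>.
\<close>

lemma star_mult_self_eq_minus_square:
  fixes x k :: "'a::unital_cstar_algebra"
  assumes k: "star k = k" and x: "star x * x = - (k * k)"
  shows "x = 0"
proof -
  \<comment> \<open>Real and imaginary parts of \<open>x\<close>. From
    \<open>star x * x + x * star x = 2 (u * u + v * v)\<close> the element \<open>x * star x\<close>
    becomes a sum of self-adjoint squares.\<close>
  define u where "u = (1/2) *\<^sub>R (x + star x)"
  define v where "v = (1/2) *\<^sub>R scaleC \<i> (star x - x)"
  have sau: "star u = u" by (simp add: u_def star_scaleR star_add star_star add.commute)
  have sav: "star v = v"
    by (simp add: v_def star_scaleR star_scaleC_i star_diff star_star scaleC_diff_right)
  have vv: "v * v = (1/4) *\<^sub>R (- ((star x - x) * (star x - x)))"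
    by (simp add: v_def mult_scaleC_left mult_scaleC_right scaleC_i_i scaleC_minus_right flip: scaleC_scaleR)
  have uu: "u * u = (1/4) *\<^sub>R ((x + star x) * (x + star x))" by (simp add: u_def)
  have "4 *\<^sub>R (u * u + v * v) = 2 *\<^sub>R (star x * x + x * star x)"
    unfolding uu vv by (simp add: algebra_simps scaleR_2)
  then have "2 *\<^sub>R (x * star x) = 2 *\<^sub>R (2 *\<^sub>R (u * u + v * v) + k * k)"
    by (simp add: x algebra_simps)
  then have "x * star x = 2 *\<^sub>R (u * u + v * v) + k * k"
    by (simp only: scaleR_cancel_left) simp
  then have "norm_positive (x * star x)"
    by (metis norm_positive_add norm_positive_scaleR norm_positive_square sau sav k zero_le_numeral)
  then obtain t where t: "t \<ge> 0" "norm (t *\<^sub>R 1 - x * star x) \<le> t"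
    unfolding norm_positive_def by blast
  show ?thesis
  proof (cases "t = 0")
    case True
    then have "norm (x * star x) = 0" using t by simp
    then show ?thesis by (simp add: norm_mult_star_self)
  next
    case False
    with t have tp: "t > 0" by simp
    define z where "z = 1 - (1/t) *\<^sub>R (x * star x)"
    define g where "g = (1 / sqrt t) *\<^sub>R k"
    define c where "c = g * g"
    have tc: "t *\<^sub>R c = k * k" using tp by (simp add: c_def g_def)
    have sag: "star g = g" by (simp add: g_def star_scaleR k)
    have sac: "star c = c" by (simp add: c_def star_mult sag)
    have tz: "t *\<^sub>R z = t *\<^sub>R 1 - x * star x" using tp by (simp add: z_def algebra_simps)
    have "t * norm z \<le> t" using t(2) tp unfolding tz[symmetric] by simp
    then have nz: "norm z \<le> 1" using tp by simp
    \<comment> \<open>This is \<open>(1 + c) ^ n * c\<close>; the recursion keeps it visible that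
      \<open>w n\<close> is a polynomial in \<open>g\<close>, hence commutes with
      \<open>g\<close>.\<close>
    define w where "w n = rec_nat c (\<lambda>_ w. w + c * w) n" for n
    have w0: "w 0 = c" and wSuc: "w (Suc n) = w n + c * w n" for n by (simp_all add: w_def)
    have gw: "g * w n = w n * g" for n
    proof (induction n)
      case (Suc n)
      have "g * (c * w n) = c * w n * g" by (metis Suc c_def mult.assoc)
      then show ?case by (simp add: wSuc distrib_left distrib_right Suc)
    qed (simp add: w0 c_def mult.assoc)
    \<comment> \<open>Bernoulli's inequality in operator form. The first conjunct is carried along
      so that \<open>c * (w n - c)\<close> is positive in the induction step.\<close>
    have pos: "norm_positive (w n - c) \<and> norm_positive (w n - c - real n *\<^sub>R (c * c))" for n
    proof (induction n)
      case (Suc n)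
      have "g * (w n - c) = (w n - c) * g"
        using gw[of n] by (simp add: algebra_simps c_def mult.assoc)
      then have p: "norm_positive (c * (w n - c))"
        using norm_positive_commuting_mult[of "w n - c" g] Suc sag by (simp add: c_def)
      have "w (Suc n) - c = (w n - c) + (c * (w n - c) + c * c)"
        by (simp add: wSuc algebra_simps)
      moreover have "w (Suc n) - c - real (Suc n) *\<^sub>R (c * c)
          = (w n - c - real n *\<^sub>R (c * c)) + c * (w n - c)"
        by (simp add: wSuc algebra_simps)
      ultimately show ?case
        using Suc p norm_positive_square[OF sac] by (metis norm_positive_add)
    qed (simp add: w0 norm_positive_zero)
    have xw: "star x * (z ^ n * x) = - (t *\<^sub>R w n)" for n
    proof (induction n)
      case (Suc n)
      have "star x * z = star x - (1/t) *\<^sub>R (star x * x * star x)"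
        by (simp add: z_def right_diff_distrib mult.assoc)
      also have "\<dots> = star x + c * star x"
        using tp by (simp add: x tc[symmetric])
      finally have "star x * (z ^ Suc n * x) = (star x + c * star x) * (z ^ n * x)"
        by (metis mult.assoc power_Suc)
      also have "\<dots> = star x * (z ^ n * x) + c * (star x * (z ^ n * x))"
        by (simp add: distrib_right mult.assoc)
      finally show ?case by (simp add: Suc wSuc algebra_simps)
    qed (simp add: w0 x tc)
    have nzn: "norm (z ^ n) \<le> 1" for n
    proof (induction n)
      case (Suc n)
      show ?case
        using mult_le_one[OF nz norm_ge_zero Suc] norm_mult_ineq[of z "z ^ n"] by simp
    qed (simp add: norm_one_le)
    have w_le: "t * norm (w n) \<le> (norm x)\<^sup>2" for n
    proof -
      have "norm (z ^ n * x) \<le> norm x"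
        using norm_mult_ineq[of "z ^ n" x] mult_right_mono[OF nzn[of n] norm_ge_zero[of x]] by simp
      then have "norm (star x * (z ^ n * x)) \<le> norm x * norm x"
        by (intro order_trans[OF norm_mult_ineq]) (simp add: norm_star mult_left_mono)
      then show ?thesis using tp by (simp add: xw power2_eq_square)
    qed
    have "real n * norm (c * c) \<le> norm (w n)" for n
    proof -
      have "norm_positive (real n *\<^sub>R (c * c))"
        by (intro norm_positive_scaleR norm_positive_square sac) simp
      moreover have "norm_positive (w n - c - real n *\<^sub>R (c * c) + c)"
        using pos[of n] norm_positive_square[OF sag] by (intro norm_positive_add) (simp_all add: c_def)
      ultimately show ?thesis
        using norm_positive_mono[of "real n *\<^sub>R (c * c)" "w n - c - real n *\<^sub>R (c * c) + c"] by simp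
    qed
    then have bound: "t * (real n * norm (c * c)) \<le> (norm x)\<^sup>2" for n
      using w_le[of n] tp by (meson mult_left_mono order_trans less_imp_le)
    have "norm (c * c) = 0"
    proof (rule ccontr)
      assume "norm (c * c) \<noteq> 0"
      then have pp: "t * norm (c * c) > 0" using tp by simp
      obtain n where "(norm x)\<^sup>2 < real n * (t * norm (c * c))"
        using reals_Archimedean3[OF pp] by blast
      then show False using bound[of n] by (simp add: mult.left_commute)
    qed
    then have "norm (star c * c) = 0" by (simp add: sac)
    then have "c = 0" by (simp only: cstar_identity) simp
    then have "k * k = 0" using tc by simp
    then have "norm (star x * x) = 0" by (simp add: x)
    then show ?thesis by (simp only: cstar_identity) simp
  qed
qed

lemma sa_square_eq_zero: "star k = k \<Longrightarrow> k * k = 0 \<Longrightarrow> k = (0::'a::unital_cstar_algebra)"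
  using cstar_identity[of k] by simp

text \<open>Here \<open>r\<close> is the absolute value of \<open>a = star b * b\<close>, and
  \<open>n = r - a\<close> is twice its negative part. Since \<open>a * n = - (r * n)\<close>, the
  element \<open>b * n\<close> satisfies
  \<open>star (b * n) * (b * n) = - (q * n) * (q * n)\<close>, where \<open>q\<close> is the root of
  \<open>r\<close>. The previous argument forces it to vanish; then \<open>n = 0\<close> and
  \<open>a = r\<close>.\<close>

lemma norm_positive_star_mult_self:
  fixes b :: "'a::unital_cstar_algebra"
  shows "norm_positive (star b * b)"
proof -
  define a where "a = star b * b"
  have sa: "star a = a" by (simp add: a_def star_mult star_star)
  obtain r where r: "norm_positive r" "star r = r" "r * r = a * a"
      "\<And>c. c * (a * a) = (a * a) * c \<Longrightarrow> c * r = r * c"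
    using norm_positive_sqrt[OF norm_positive_square[OF sa]] by blast
  have ar: "a * r = r * a" by (rule r(4)) (simp add: mult.assoc)
  obtain q where q: "star q = q" "q * q = r" "\<And>c. c * r = r * c \<Longrightarrow> c * q = q * c"
    using norm_positive_sqrt[OF r(1)] by blast
  define n where "n = r - a"
  have san: "star n = n" by (simp add: n_def star_diff r(2) sa)
  have rn: "r * n = n * r" by (simp add: n_def algebra_simps ar)
  have qn: "n * q = q * n" by (rule q(3)) (simp add: rn)
  have an: "a * n = - (r * n)" by (simp add: n_def algebra_simps ar r(3))
  have na: "n * a = - (r * n)" by (simp add: n_def algebra_simps ar r(3))
  have nn: "n * n = 2 *\<^sub>R (r * n)"
    by (simp add: n_def algebra_simps ar r(3) scaleR_2)
  have "star (b * n) * (b * n) = n * a * n"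
    by (simp add: star_mult san a_def mult.assoc)
  also have "\<dots> = - (r * (n * n))" by (simp add: na mult.assoc)
  also have "r * (n * n) = (q * n) * (q * n)"
    by (metis mult.assoc q(2) qn)
  finally have *: "star (b * n) * (b * n) = - ((q * n) * (q * n))" .
  have sqn: "star (q * n) = q * n" by (simp add: star_mult q san qn)
  have "b * n = 0" using star_mult_self_eq_minus_square[OF sqn *] .
  then have "(q * n) * (q * n) = 0" using * by (simp add: star_zero)
  then have "q * n = 0" using sa_square_eq_zero[OF sqn] by blast
  then have "r * n = 0" by (metis q(2) mult.assoc mult_zero_right)
  then have "n * n = 0" by (simp add: nn)
  then have "n = 0" using sa_square_eq_zero[OF san] by blast
  then show ?thesis using r(1) by (simp add: n_def a_def)
qed

section \<open>The order of the algebra\<close>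

lemma positive_iff_norm_positive: "positive a \<longleftrightarrow> norm_positive a"
  using norm_positive_star_mult_self norm_positive_sqrt[of a] unfolding positive_def by metis

lemma positive_zero: "positive 0"
  by (simp add: positive_iff_norm_positive norm_positive_zero)

lemma positive_add: "positive a \<Longrightarrow> positive b \<Longrightarrow> positive (a + b)"
  by (simp add: positive_iff_norm_positive norm_positive_add)

lemma positive_scaleR: "positive a \<Longrightarrow> 0 \<le> r \<Longrightarrow> positive (r *\<^sub>R a)"
  by (simp add: positive_iff_norm_positive norm_positive_scaleR)

lemma positive_star: "positive a \<Longrightarrow> star a = a"
  by (simp add: positive_iff_norm_positive norm_positive_def)

lemma positive_star_mult_self: "positive (star a * a)"
  unfolding positive_def by blast

lemma positive_congruence: "positive a \<Longrightarrow> positive (star b * a * b)"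
  unfolding positive_def by (metis mult.assoc star_mult)

lemma positive_norm_diff: "star a = a \<Longrightarrow> positive (norm a *\<^sub>R 1 - a)"
  by (simp add: positive_iff_norm_positive norm_positive_norm_diff)

lemma positive_norm_mono: "positive a \<Longrightarrow> positive (b - a) \<Longrightarrow> norm a \<le> norm b"
  using norm_positive_mono[of a "b - a"] by (simp add: positive_iff_norm_positive)

lemma positive_sum: "(\<And>i. i \<in> F \<Longrightarrow> positive (f i)) \<Longrightarrow> positive (sum f F)"
  by (induction F rule: infinite_finite_induct) (auto intro: positive_add positive_zero)

text \<open>For positive \<open>b\<close> the radius \<open>t\<close> in
  \<open>norm_positive\<close> can be taken to be \<open>norm b\<close>. With this choice the
  condition is continuous in \<open>b\<close> and passes to the limit.\<close>

lemma positive_closed: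
  fixes a :: "'a::unital_cstar_algebra"
  assumes approx: "\<And>e. e > 0 \<Longrightarrow> \<exists>b. positive b \<and> norm (a - b) < e"
  shows "positive a"
proof -
  have nb: "norm (norm b *\<^sub>R 1 - b) \<le> norm b" if "positive b" for b :: 'a
    by (rule norm_positive_norm_le)
       (use that positive_norm_diff[of b] positive_star[of b] in \<open>simp_all flip: positive_iff_norm_positive\<close>)
  have "star a = a"
  proof (rule ccontr)
    assume "star a \<noteq> a"
    then have "norm (star a - a) / 2 > 0" by simp
    then obtain b where b: "positive b" "norm (a - b) < norm (star a - a) / 2"
      using approx by blast
    have "star a - a = star (a - b) - (a - b)"
      by (simp add: star_diff positive_star[OF b(1)])
    then have "norm (star a - a) \<le> 2 * norm (a - b)"
      using norm_triangle_ineq4[of "star (a - b)" "a - b"] by (simp only: norm_star)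
    then show False using b by simp
  qed
  moreover have "norm (norm a *\<^sub>R 1 - a) \<le> norm a"
  proof (rule field_le_epsilon)
    fix e :: real assume "e > 0"
    then obtain b where b: "positive b" "norm (a - b) < e / 3"
      using approx[of "e / 3"] by auto
    have eq: "norm a *\<^sub>R 1 - a = (norm b *\<^sub>R 1 - b) + ((norm a - norm b) *\<^sub>R 1 - (a - b))"
      by (simp add: algebra_simps)
    have "norm ((norm a - norm b) *\<^sub>R (1::'a)) \<le> norm (a - b)"
    proof -
      have "\<bar>norm a - norm b\<bar> * norm (1::'a) \<le> norm (a - b) * 1"
        by (intro mult_mono norm_triangle_ineq3 norm_one_le) simp_all
      then show ?thesis by simp
    qed
    then have "norm (norm a *\<^sub>R 1 - a) \<le> norm b + (norm (a - b) + norm (a - b))"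
      unfolding eq
      using nb[OF b(1)] norm_triangle_ineq[of "norm b *\<^sub>R 1 - b" "(norm a - norm b) *\<^sub>R 1 - (a - b)"]
        norm_triangle_ineq4[of "(norm a - norm b) *\<^sub>R 1" "a - b"] by linarith
    moreover have "norm b \<le> norm a + norm (a - b)"
      using norm_triangle_ineq4[of a "a - b"] by simp
    ultimately show "norm (norm a *\<^sub>R 1 - a) \<le> norm a + e" using b by linarith
  qed
  ultimately have "norm_positive a"
    unfolding norm_positive_def by (intro conjI exI[of _ "norm a"]) simp_all
  then show ?thesis by (simp add: positive_iff_norm_positive)
qed

section \<open>Unconditional sums of positive elements\<close>

lemma sum_positive_mono:
  fixes g :: "'i \<Rightarrow> 'a::unital_cstar_algebra"
  assumes "finite G" "F \<subseteq> G" "\<And>i. i \<in> G \<Longrightarrow> positive (g i)"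
  shows "positive (sum g G - sum g F)"
  using assms by (auto simp: sum_diff[symmetric] intro: positive_sum)

text \<open>Once a finite \<open>F\<close> leaves a small remainder, every larger \<open>Y\<close>
  does too: the remainder of \<open>Y\<close> is positive and below that of \<open>F\<close>, and
  the norm is monotone on positive elements.\<close>

lemma has_sum_positive_iff:
  fixes g :: "'i \<Rightarrow> 'a::unital_cstar_algebra"
  assumes pos: "\<And>i. i \<in> I \<Longrightarrow> positive (g i)"
  shows "(g has_sum h) I \<longleftrightarrow>
    (\<forall>F. finite F \<and> F \<subseteq> I \<longrightarrow> positive (h - sum g F)) \<and>
    (\<forall>e>0. \<exists>F. finite F \<and> F \<subseteq> I \<and> norm (h - sum g F) < e)" (is "?L \<longleftrightarrow> ?B \<and> ?A")
proof
  assume L: ?L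
  have ev: "\<exists>X. finite X \<and> X \<subseteq> I \<and> (\<forall>Y. finite Y \<and> X \<subseteq> Y \<and> Y \<subseteq> I \<longrightarrow> norm (h - sum g Y) < e)"
    if "e > 0" for e
    using L that unfolding has_sum_def tendsto_iff eventually_finite_subsets_at_top
    by (simp add: dist_norm norm_minus_commute)
  show "?B \<and> ?A"
  proof (intro conjI allI impI)
    fix F assume F: "finite F \<and> F \<subseteq> I"
    show "positive (h - sum g F)"
    proof (rule positive_closed)
      fix e :: real assume "e > 0"
      then obtain X where X: "finite X" "X \<subseteq> I"
          "\<And>Y. finite Y \<Longrightarrow> X \<subseteq> Y \<Longrightarrow> Y \<subseteq> I \<Longrightarrow> norm (h - sum g Y) < e"
        using ev by metis
      have "norm (h - sum g F - (sum g (X \<union> F) - sum g F)) < e"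
        using X(3)[of "X \<union> F"] X F by simp
      moreover have "positive (sum g (X \<union> F) - sum g F)"
        using X F pos by (intro sum_positive_mono) auto
      ultimately show "\<exists>b. positive b \<and> norm (h - sum g F - b) < e" by blast
    qed
  next
    fix e :: real assume "e > 0"
    then show "\<exists>F. finite F \<and> F \<subseteq> I \<and> norm (h - sum g F) < e"
      using ev by (meson subset_refl)
  qed
next
  assume R: "?B \<and> ?A"
  show ?L
    unfolding has_sum_def tendsto_iff eventually_finite_subsets_at_top
  proof (intro allI impI)
    fix e :: real assume "e > 0"
    then obtain F where F: "finite F" "F \<subseteq> I" "norm (h - sum g F) < e" using R by blast
    have "dist (sum g Y) h < e" if Y: "finite Y" "F \<subseteq> Y" "Y \<subseteq> I" for Y
    proof -
      have "positive (h - sum g F - (h - sum g Y))"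
        using sum_positive_mono[of Y F g] Y pos by auto
      then have "norm (h - sum g Y) \<le> norm (h - sum g F)"
        using R Y by (intro positive_norm_mono) auto
      then show ?thesis using F by (simp add: dist_norm norm_minus_commute)
    qed
    then show "\<exists>X. finite X \<and> X \<subseteq> I \<and> (\<forall>Y. finite Y \<and> X \<subseteq> Y \<and> Y \<subseteq> I \<longrightarrow> dist (sum g Y) h < e)"
      using F by blast
  qed
qed

text \<open>A Tonelli theorem. Upper bounds come from enclosing a finite set in a rectangle;
  approximation comes from a finite \<open>A\<close> for the outer sum and, for each
  \<open>i\<close> in \<open>A\<close>, a separate finite \<open>B i\<close>.\<close>

lemma has_sum_Times_positive:
  fixes g :: "'i \<Rightarrow> 'j \<Rightarrow> 'a::unital_cstar_algebra"
  assumes pos: "\<And>i j. i \<in> I \<Longrightarrow> j \<in> J \<Longrightarrow> positive (g i j)"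
    and inner: "\<And>i. i \<in> I \<Longrightarrow> (g i has_sum s i) J"
    and outer: "(s has_sum h) I"
  shows "((\<lambda>(i, j). g i j) has_sum h) (I \<times> J)"
proof -
  have inner_le: "positive (s i - sum (g i) F)" if "i \<in> I" "finite F" "F \<subseteq> J" for i F
    using has_sum_positive_iff[of J "g i" "s i"] pos inner that by blast
  have "positive (s i)" if "i \<in> I" for i using inner_le[OF that, of "{}"] by simp
  then have outer': "(\<forall>F. finite F \<and> F \<subseteq> I \<longrightarrow> positive (h - sum s F)) \<and>
      (\<forall>e>0. \<exists>F. finite F \<and> F \<subseteq> I \<and> norm (h - sum s F) < e)"
    using has_sum_positive_iff[of I s h] outer by blast
  show ?thesis
  proof (subst has_sum_positive_iff, goal_cases)
    case 2
    show ?case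
    proof (intro conjI allI impI)
      fix F assume F: "finite F \<and> F \<subseteq> I \<times> J"
      define A B where "A = fst ` F" and "B = snd ` F"
      have AB: "finite A" "finite B" "A \<subseteq> I" "B \<subseteq> J" "F \<subseteq> A \<times> B"
        using F by (auto simp: A_def B_def rev_image_eqI)
      have "positive ((\<Sum>p\<in>A \<times> B. case p of (i, j) \<Rightarrow> g i j) - (\<Sum>p\<in>F. case p of (i, j) \<Rightarrow> g i j))"
        using AB pos by (intro sum_positive_mono) (auto simp: subset_iff)
      moreover have "(\<Sum>p\<in>A \<times> B. case p of (i, j) \<Rightarrow> g i j) = (\<Sum>i\<in>A. sum (g i) B)"
        by (simp add: sum.cartesian_product)
      moreover have "positive (\<Sum>i\<in>A. s i - sum (g i) B)"
        using AB inner_le by (intro positive_sum) auto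
      moreover have "positive (h - sum s A)" using outer' AB by blast
      ultimately have "positive ((h - sum s A) + (\<Sum>i\<in>A. s i - sum (g i) B)
          + ((\<Sum>i\<in>A. sum (g i) B) - (\<Sum>p\<in>F. case p of (i, j) \<Rightarrow> g i j)))"
        by (metis positive_add)
      then show "positive (h - (\<Sum>p\<in>F. case p of (i, j) \<Rightarrow> g i j))"
        by (simp add: sum_subtractf)
    next
      fix e :: real assume e: "e > 0"
      then obtain A where A: "finite A" "A \<subseteq> I" "norm (h - sum s A) < e / 2"
        using outer' half_gt_zero by blast
      \<comment> \<open>The inner errors add up to at most half of \<open>e\<close>; the added 1
        avoids division by zero when \<open>A\<close> is empty.\<close>
      define d where "d = e / (2 * (real (card A) + 1))"
      have d: "d > 0" using e by (simp add: d_def)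
      have "\<exists>B. finite B \<and> B \<subseteq> J \<and> norm (s i - sum (g i) B) < d" if "i \<in> A" for i
        using has_sum_positive_iff[of J "g i" "s i"] pos inner that A d by blast
      then obtain B where B: "\<And>i. i \<in> A \<Longrightarrow> finite (B i) \<and> B i \<subseteq> J \<and> norm (s i - sum (g i) (B i)) < d"
        by metis
      have "norm (\<Sum>i\<in>A. s i - sum (g i) (B i)) \<le> real (card A) * d"
        using B by (intro order_trans[OF norm_sum] sum_bounded_above less_imp_le) auto
      also have "\<dots> \<le> e / 2" using e by (simp add: d_def field_simps)
      finally have "norm ((h - sum s A) + (\<Sum>i\<in>A. s i - sum (g i) (B i))) < e"
        using A norm_triangle_ineq[of "h - sum s A" "\<Sum>i\<in>A. s i - sum (g i) (B i)"] by linarith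
      moreover have "(\<Sum>p\<in>Sigma A B. case p of (i, j) \<Rightarrow> g i j) = (\<Sum>i\<in>A. sum (g i) (B i))"
        using A B by (simp add: sum.Sigma)
      ultimately have "norm (h - (\<Sum>p\<in>Sigma A B. case p of (i, j) \<Rightarrow> g i j)) < e"
        by (simp add: sum_subtractf)
      moreover have "finite (Sigma A B)" "Sigma A B \<subseteq> I \<times> J" using A B by auto
      ultimately show "\<exists>F. finite F \<and> F \<subseteq> I \<times> J \<and> norm (h - (\<Sum>p\<in>F. case p of (i, j) \<Rightarrow> g i j)) < e"
        by blast
    qed
  qed (use pos in auto)
qed

section \<open>Hilbert modules\<close>

lemma positive_LIMSEQ:
  assumes "\<And>n. positive (a n)" "a \<longlonglongrightarrow> l" shows "positive (l :: 'a::unital_cstar_algebra)"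
proof (rule positive_closed)
  fix e :: real assume "e > 0"
  then obtain n where "norm (a n - l) < e" using LIMSEQ_D[OF assms(2)] by blast
  then show "\<exists>b. positive b \<and> norm (l - b) < e"
    using assms(1) by (metis norm_minus_commute)
qed

definition hminus :: "('x, 'a::unital_cstar_algebra, 'z) hmod_scheme \<Rightarrow> 'x \<Rightarrow> 'x \<Rightarrow> 'x" where
  "hminus X x y = hadd X x (ract X y (- 1))"

definition hnorm :: "('x, 'a::unital_cstar_algebra, 'z) hmod_scheme \<Rightarrow> 'x \<Rightarrow> real" where
  "hnorm X x = sqrt (norm (ip X x x))"

lemma hdist_eq_hnorm: "hdist X x y = hnorm X (hminus X x y)"
  by (simp add: hdist_def hnorm_def hminus_def Let_def)

lemma hnorm_nonneg [simp]: "0 \<le> hnorm X x"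
  by (simp add: hnorm_def)

lemma hnorm_power2: "(hnorm X x)\<^sup>2 = norm (ip X x x)"
  by (simp add: hnorm_def)

lemma hdist_nonneg [simp]: "0 \<le> hdist X x y"
  by (simp add: hdist_eq_hnorm)

context hilbert_module
begin

lemma hminus_closed: "x \<in> hcar X \<Longrightarrow> y \<in> hcar X \<Longrightarrow> hminus X x y \<in> hcar X"
  by (simp add: hminus_def add_closed ract_closed)

lemma ip_zero_right: "x \<in> hcar X \<Longrightarrow> ip X x (hzero X) = 0"
  using ip_add_right[of x "hzero X" "hzero X"] add_zero[OF zero_closed] zero_closed by simp

lemma ip_zero_left: "x \<in> hcar X \<Longrightarrow> ip X (hzero X) x = 0"
  using ip_star[of x "hzero X"] zero_closed by (simp add: ip_zero_right star_zero)

lemma ip_add_left: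
  "x \<in> hcar X \<Longrightarrow> y \<in> hcar X \<Longrightarrow> z \<in> hcar X \<Longrightarrow> ip X (hadd X x y) z = ip X x z + ip X y z"
  using ip_star[of z "hadd X x y"] ip_star[of z x] ip_star[of z y]
  by (simp add: add_closed ip_add_right star_add)

lemma ip_ract_left: "x \<in> hcar X \<Longrightarrow> y \<in> hcar X \<Longrightarrow> ip X (ract X x a) y = star a * ip X x y"
  using ip_star[of y "ract X x a"] ip_star[of y x] by (simp add: ract_closed ip_ract_right star_mult)

lemma ip_minus_right:
  "x \<in> hcar X \<Longrightarrow> y \<in> hcar X \<Longrightarrow> z \<in> hcar X \<Longrightarrow> ip X x (hminus X y z) = ip X x y - ip X x z"
  by (simp add: hminus_def ip_add_right ip_ract_right ract_closed)

lemma ip_minus_left: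
  "x \<in> hcar X \<Longrightarrow> y \<in> hcar X \<Longrightarrow> z \<in> hcar X \<Longrightarrow> ip X (hminus X x y) z = ip X x z - ip X y z"
  by (simp add: hminus_def ip_add_left ip_ract_left ract_closed star_minus star_one)

lemmas ip_simps = ip_zero_right ip_zero_left ip_add_left ip_add_right ip_ract_left ip_ract_right
  ip_minus_left ip_minus_right
lemmas closed_simps = zero_closed add_closed ract_closed hminus_closed

text \<open>Negation is not an operation of the record. That \<open>y \<cdot> (-1)\<close> is an
  additive inverse of \<open>y\<close> follows from definiteness, as their sum has length
  zero.\<close>

lemma hminus_eq_zeroD:
  assumes "x \<in> hcar X" "y \<in> hcar X" "hminus X x y = hzero X" shows "x = y"
proof -
  define y' where "y' = ract X y (- 1)"
  have y': "y' \<in> hcar X" using assms by (simp add: y'_def ract_closed)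
  have "ip X (hminus X y y) (hminus X y y) = 0" using assms by (simp add: ip_simps closed_simps)
  then have yy: "hadd X y y' = hzero X"
    using ip_definite hminus_closed assms by (simp add: hminus_def y'_def)
  have xy: "hadd X x y' = hzero X" using assms by (simp add: hminus_def y'_def)
  have "x = hadd X x (hadd X y' y)" using assms y' yy by (simp add: add_zero add_commute[of y' y])
  also have "\<dots> = hadd X (hzero X) y" using assms y' by (simp add: add_assoc[symmetric] xy)
  also have "\<dots> = y" using assms by (simp add: add_commute[of "hzero X"] add_zero zero_closed)
  finally show ?thesis .
qed

text \<open>The squared length of \<open>x - y\<close> expands into these four products. Module
  identities thus reduce to computations in the algebra, in particular the linearity of
  isometries.\<close>

lemma eq_by_ip:
  assumes "x \<in> hcar X" "y \<in> hcar X" "ip X x x = ip X x y" "ip X y x = ip X y y"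
  shows "x = y"
proof (rule hminus_eq_zeroD[OF assms(1,2)], rule ip_definite)
  show "ip X (hminus X x y) (hminus X x y) = 0"
    using assms by (simp add: ip_simps closed_simps)
qed (simp add: assms hminus_closed)

lemma ext_ip:
  assumes "x \<in> hcar X" "y \<in> hcar X" "\<And>w. w \<in> hcar X \<Longrightarrow> ip X w x = ip X w y"
  shows "x = y"
  using assms by (intro eq_by_ip) auto

text \<open>Positivity of the square of \<open>x \<cdot> (a / r) - y\<close>, with
  \<open>a = ip X x y\<close> and \<open>r = norm (ip X x x)\<close>, combined with
  \<open>star a * ip X x x * a \<le> r (star a * a)\<close>, leaves
  \<open>star a * a / r \<le> ip X y y\<close>; monotonicity of the norm finishes.\<close>

lemma cauchy_schwarz:
  assumes xy: "x \<in> hcar X" "y \<in> hcar X"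
  shows "norm (ip X x y) \<le> hnorm X x * hnorm X y"
proof (cases "ip X x x = 0")
  case True
  then have "x = hzero X" using ip_definite xy by blast
  then show ?thesis using xy by (simp add: ip_zero_left)
next
  case False
  define r where "r = norm (ip X x x)"
  define a where "a = ip X x y"
  have r: "r > 0" using False by (simp add: r_def)
  define z where "z = hminus X (ract X x ((1/r) *\<^sub>R a)) y"
  have a': "ip X y x = star a" using ip_star[of x y] xy by (simp add: a_def)
  have "positive (ip X z z)" using xy by (intro ip_positive) (simp add: z_def closed_simps)
  moreover have "ip X z z = (1/r) *\<^sub>R ((1/r) *\<^sub>R (star a * ip X x x * a)) - (1/r) *\<^sub>R (star a * a)
      - (1/r) *\<^sub>R (star a * a) + ip X y y"
    using xy by (simp add: z_def ip_simps closed_simps a' a_def[symmetric] star_scaleR algebra_simps)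
  moreover have "positive ((1/r) *\<^sub>R ((1/r) *\<^sub>R (star a * (r *\<^sub>R 1 - ip X x x) * a)))"
    using r positive_norm_diff[OF positive_star[OF ip_positive[OF xy(1)]]]
    by (intro positive_scaleR positive_congruence) (auto simp: r_def)
  ultimately have "positive (((1/r) *\<^sub>R ((1/r) *\<^sub>R (star a * ip X x x * a)) - (1/r) *\<^sub>R (star a * a)
      - (1/r) *\<^sub>R (star a * a) + ip X y y) + (1/r) *\<^sub>R ((1/r) *\<^sub>R (star a * (r *\<^sub>R 1 - ip X x x) * a)))"
    by (metis positive_add)
  also have "\<dots> = ip X y y - (1/r) *\<^sub>R (star a * a)"
    using r by (simp add: algebra_simps)
  finally have "norm ((1/r) *\<^sub>R (star a * a)) \<le> norm (ip X y y)"
    using r by (intro positive_norm_mono positive_scaleR positive_star_mult_self) auto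
  then have "(norm a)\<^sup>2 \<le> r * norm (ip X y y)"
    using r by (simp add: cstar_identity field_simps)
  then have "(norm a)\<^sup>2 \<le> (hnorm X x * hnorm X y)\<^sup>2"
    by (simp add: power_mult_distrib hnorm_power2 r_def)
  then show ?thesis unfolding a_def by (rule power2_le_imp_le) simp
qed

lemma hnorm_triangle:
  assumes xy: "x \<in> hcar X" "y \<in> hcar X"
  shows "hnorm X (hadd X x y) \<le> hnorm X x + hnorm X y"
proof (rule power2_le_imp_le)
  have "norm (ip X (hadd X x y) (hadd X x y))
      \<le> norm (ip X x x) + norm (ip X x y) + norm (ip X y x) + norm (ip X y y)"
    using xy norm_triangle_ineq[of "ip X x x + ip X y x" "ip X x y + ip X y y"]
      norm_triangle_ineq[of "ip X x x" "ip X y x"] norm_triangle_ineq[of "ip X x y" "ip X y y"]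
    by (simp add: ip_simps closed_simps)
  also have "\<dots> \<le> (hnorm X x)\<^sup>2 + hnorm X x * hnorm X y + hnorm X y * hnorm X x + (hnorm X y)\<^sup>2"
    by (intro add_mono cauchy_schwarz xy) (simp_all add: hnorm_power2)
  also have "\<dots> = (hnorm X x + hnorm X y)\<^sup>2" by (simp add: power2_eq_square algebra_simps)
  finally show "(hnorm X (hadd X x y))\<^sup>2 \<le> (hnorm X x + hnorm X y)\<^sup>2" by (simp add: hnorm_power2)
qed simp

lemma hdist_triangle:
  assumes "x \<in> hcar X" "y \<in> hcar X" "z \<in> hcar X"
  shows "hdist X x z \<le> hdist X x y + hdist X y z"
proof -
  have "hminus X x z = hadd X (hminus X x y) (hminus X y z)"
    using assms by (intro ext_ip) (simp_all add: ip_simps closed_simps)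
  then show ?thesis
    using assms hnorm_triangle[of "hminus X x y" "hminus X y z"] by (simp add: hdist_eq_hnorm hminus_closed)
qed

lemma hdist_commute: "x \<in> hcar X \<Longrightarrow> y \<in> hcar X \<Longrightarrow> hdist X x y = hdist X y x"
  by (simp add: hdist_eq_hnorm hnorm_def ip_simps closed_simps algebra_simps)

lemma hdist_self: "x \<in> hcar X \<Longrightarrow> hdist X x x = 0"
  by (simp add: hdist_eq_hnorm hnorm_def ip_simps closed_simps)

lemma tendsto_ip:
  assumes s: "\<And>n. s n \<in> hcar X" "x \<in> hcar X" "(\<lambda>n. hdist X (s n) x) \<longlonglongrightarrow> 0"
    and r: "\<And>n. r n \<in> hcar X" "y \<in> hcar X" "(\<lambda>n. hdist X (r n) y) \<longlonglongrightarrow> 0"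
  shows "(\<lambda>n. ip X (s n) (r n)) \<longlonglongrightarrow> ip X x y"
proof -
  have le: "norm (ip X (s n) (r n) - ip X x y)
      \<le> hdist X (s n) x * (hnorm X y + hdist X (r n) y) + hnorm X x * hdist X (r n) y" for n
  proof -
    have eq: "ip X (s n) (r n) - ip X x y = ip X (hminus X (s n) x) y
        + ip X (hminus X (s n) x) (hminus X (r n) y) + ip X x (hminus X (r n) y)"
      using s(1,2) r(1,2) by (simp add: ip_simps closed_simps)
    show ?thesis
      unfolding eq hdist_eq_hnorm distrib_left
      by (intro order_trans[OF norm_triangle_ineq] add_mono cauchy_schwarz hminus_closed s r)
  qed
  have "(\<lambda>n. hdist X (s n) x * (hnorm X y + hdist X (r n) y) + hnorm X x * hdist X (r n) y)
      \<longlonglongrightarrow> 0 * (hnorm X y + 0) + hnorm X x * 0"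
    by (intro tendsto_intros s r)
  then have "(\<lambda>n. ip X (s n) (r n) - ip X x y) \<longlonglongrightarrow> 0"
    by (intro Lim_null_comparison[OF always_eventually[OF allI[OF le]]]) simp
  then show ?thesis by (simp add: LIM_zero_iff)
qed

lemma tendsto_ip_const:
  assumes "\<And>n. s n \<in> hcar X" "x \<in> hcar X" "(\<lambda>n. hdist X (s n) x) \<longlonglongrightarrow> 0" "y \<in> hcar X"
  shows "(\<lambda>n. ip X (s n) y) \<longlonglongrightarrow> ip X x y" "(\<lambda>n. ip X y (s n)) \<longlonglongrightarrow> ip X y x"
  using tendsto_ip[OF assms(1-3), of "\<lambda>_. y"] tendsto_ip[of "\<lambda>_. y" y s x] assms
  by (simp_all add: hdist_self)

lemma hdense_sequence:
  assumes "hdense X S" "x \<in> hcar X"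
  shows "\<exists>s. (\<forall>n. s n \<in> S) \<and> (\<lambda>n. hdist X (s n) x) \<longlonglongrightarrow> 0"
proof -
  have "\<exists>y\<in>S. hdist X x y < inverse (real (Suc n))" for n
    using assms unfolding hdense_def by simp
  then obtain s where s: "\<And>n. s n \<in> S" "\<And>n. hdist X x (s n) < inverse (real (Suc n))" by metis
  have "s n \<in> hcar X" for n using s assms unfolding hdense_def by blast
  then have "norm (hdist X (s n) x) \<le> inverse (real (Suc n))" for n
    using s(2)[of n] assms by (simp add: hdist_commute[of "s n"])
  then show ?thesis
    using s(1) by (intro exI[of _ s] conjI Lim_null_comparison[OF always_eventually LIMSEQ_inverse_real_of_nat]) auto
qed

lemma hdist_Cauchy:
  assumes s: "\<And>n. s n \<in> hcar X" "x \<in> hcar X" "(\<lambda>n. hdist X (s n) x) \<longlonglongrightarrow> 0" and "e > 0"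
  shows "\<exists>N. \<forall>i\<ge>N. \<forall>j\<ge>N. hdist X (s i) (s j) < e"
proof -
  obtain N where N: "\<And>n. n \<ge> N \<Longrightarrow> hdist X (s n) x < e / 2"
    using LIMSEQ_D[OF s(3), of "e/2"] \<open>e > 0\<close> by auto
  have "hdist X (s i) (s j) < e" if "i \<ge> N" "j \<ge> N" for i j
    using hdist_triangle[of "s i" x "s j"] hdist_commute[of x "s j"] N[OF that(1)] N[OF that(2)] s by simp
  then show ?thesis by blast
qed

end

section \<open>Inner-product preserving maps and their extension\<close>

lemma ip_preserving_closed: "ip_preserving X Y f \<Longrightarrow> x \<in> hcar X \<Longrightarrow> f x \<in> hcar Y"
  and ip_preserving_ip:
    "ip_preserving X Y f \<Longrightarrow> x \<in> hcar X \<Longrightarrow> y \<in> hcar X \<Longrightarrow> ip Y (f x) (f y) = ip X x y"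
  unfolding ip_preserving_def by blast+

lemma
  assumes X: "hilbert_module X" and Y: "hilbert_module Y" and f: "ip_preserving X Y f"
  shows ip_preserving_add: "x \<in> hcar X \<Longrightarrow> y \<in> hcar X \<Longrightarrow> f (hadd X x y) = hadd Y (f x) (f y)"
    and ip_preserving_ract: "x \<in> hcar X \<Longrightarrow> f (ract X x a) = ract Y (f x) a"
    and ip_preserving_zero: "f (hzero X) = hzero Y"
    and ip_preserving_hdist: "x \<in> hcar X \<Longrightarrow> y \<in> hcar X \<Longrightarrow> hdist Y (f x) (f y) = hdist X x y"
    and ip_preserving_inj: "inj_on f (hcar X)"
proof -
  interpret X: hilbert_module X by (rule X)
  interpret Y: hilbert_module Y by (rule Y)
  note simps = ip_preserving_closed[OF f] ip_preserving_ip[OF f] X.ip_simps Y.ip_simps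
    X.closed_simps Y.closed_simps
  show "x \<in> hcar X \<Longrightarrow> y \<in> hcar X \<Longrightarrow> f (hadd X x y) = hadd Y (f x) (f y)"
    by (rule Y.eq_by_ip) (simp_all add: simps)
  show "x \<in> hcar X \<Longrightarrow> f (ract X x a) = ract Y (f x) a"
    by (rule Y.eq_by_ip) (simp_all add: simps mult.assoc)
  show "f (hzero X) = hzero Y"
    by (rule Y.eq_by_ip) (simp_all add: simps)
  show "x \<in> hcar X \<Longrightarrow> y \<in> hcar X \<Longrightarrow> hdist Y (f x) (f y) = hdist X x y"
    by (simp add: hdist_eq_hnorm hnorm_def simps)
  show "inj_on f (hcar X)"
  proof (rule inj_onI)
    fix x y assume xy: "x \<in> hcar X" "y \<in> hcar X" "f x = f y"
    then show "x = y"
      using ip_preserving_ip[OF f] by (intro X.eq_by_ip) metis+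
  qed
qed

text \<open>A Cauchy sequence in the range pulls back to a Cauchy sequence in \<open>L\<close>
  because \<open>f\<close> is isometric, so completeness of \<open>L\<close> gives that of the
  range.\<close>

lemma hilbert_module_image:
  fixes L :: "('l, 'a::unital_cstar_algebra, 'w) hmod_scheme" and X :: "('x, 'a, 'z) hmod_scheme"
  assumes L: "hilbert_module L" and X: "hilbert_module X" and f: "ip_preserving L X f"
  shows "hilbert_module (X\<lparr>hcar := f ` hcar L\<rparr>)"
proof -
  interpret L: hilbert_module L by (rule L)
  interpret X: hilbert_module X by (rule X)
  have fX: "f y \<in> hcar X" if "y \<in> hcar L" for y using f that by (rule ip_preserving_closed)
  have hdist: "hdist (X\<lparr>hcar := f ` hcar L\<rparr>) = hdist X" by (intro ext) (simp add: hdist_def)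
  show ?thesis
  \<comment> \<open>Cases 1, 2, 6 and 7 are closure under zero, sum, negation and right action, and
    case 17 is completeness; the other axioms are inherited from \<open>X\<close>.\<close>
  proof (unfold_locales, unfold hdist, goal_cases)
    case 1
    show ?case using imageI[OF L.zero_closed, of f] by (simp add: ip_preserving_zero[OF L X f])
  next
    case (2 x y)
    then show ?case using ip_preserving_add[OF L X f] L.add_closed by auto (metis imageI)
  next
    case (6 x)
    then obtain y where y: "x = f y" "y \<in> hcar L" by auto
    then obtain y' where "y' \<in> hcar L" "hadd L y y' = hzero L" using L.add_inverse by blast
    then show ?case
      using y ip_preserving_add[OF L X f, of y y'] ip_preserving_zero[OF L X f] by auto
  next
    case (7 x a)
    then show ?case using ip_preserving_ract[OF L X f] L.ract_closed by auto (metis imageI)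
  next
    case (17 s)
    have "\<exists>y. y \<in> hcar L \<and> s n = f y" for n using 17(1)[of n] by auto
    then obtain r where r: "\<And>n. r n \<in> hcar L" "\<And>n. s n = f (r n)" by metis
    have "\<exists>N. \<forall>i\<ge>N. \<forall>j\<ge>N. hdist L (r i) (r j) < e" if "e > 0" for e
      using 17(2)[OF that] r ip_preserving_hdist[OF L X f] by simp
    then obtain y where "y \<in> hcar L" "(\<lambda>n. hdist L (r n) y) \<longlonglongrightarrow> 0"
      using L.complete[of r] r(1) by blast
    then show ?case using r ip_preserving_hdist[OF L X f] by auto
  qed (auto simp: fX X.add_assoc X.add_commute X.add_zero X.ract_add_left X.ract_add_right X.ract_mult
      X.ract_one X.ip_simps X.ip_positive intro: X.ip_definite X.ip_star)
qed

text \<open>A relation rather than a function, since an element may be given by several sums of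
  elementary tensors. Preservation of inner products makes \<open>G\<close> single-valued and the
  limits independent of the approximating sequences.\<close>

lemma isometric_relation_extends:
  fixes T :: "('t, 'a::unital_cstar_algebra, 'z) hmod_scheme" and T' :: "('s, 'a, 'w) hmod_scheme"
  assumes T: "hilbert_module T" and T': "hilbert_module T'"
    and G: "G \<subseteq> hcar T \<times> hcar T'"
    and ip: "\<And>z z' w w'. (z, z') \<in> G \<Longrightarrow> (w, w') \<in> G \<Longrightarrow> ip T' z' w' = ip T z w"
    and dense: "hdense T (Domain G)"
  shows "\<exists>f. ip_preserving T T' f \<and> (\<forall>(z, z')\<in>G. f z = z')"
proof -
  interpret T: hilbert_module T by (rule T)
  interpret T': hilbert_module T' by (rule T')
  define lim where "lim z z' s s' \<longleftrightarrow> (\<forall>n. (s n, s' n) \<in> G) \<and>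
      (\<lambda>n. hdist T (s n) z) \<longlonglongrightarrow> 0 \<and> (\<lambda>n. hdist T' (s' n) z') \<longlonglongrightarrow> 0" for z z' s s'
  have ex: "\<exists>z'. z' \<in> hcar T' \<and> (\<exists>s s'. lim z z' s s')" if z: "z \<in> hcar T" for z
  proof -
    obtain s where s: "\<And>n. s n \<in> Domain G" "(\<lambda>n. hdist T (s n) z) \<longlonglongrightarrow> 0"
      using T.hdense_sequence[OF dense z] by blast
    have "\<exists>z'. (s n, z') \<in> G" for n using s(1)[of n] by blast
    then obtain s' where s': "\<And>n. (s n, s' n) \<in> G" by metis
    then have cl: "s n \<in> hcar T" "s' n \<in> hcar T'" for n using G by auto
    have "hdist T' (s' i) (s' j) = hdist T (s i) (s j)" for i j
      using cl ip[OF s' s'] by (simp add: hdist_eq_hnorm hnorm_def T.ip_simps T'.ip_simps T.closed_simps T'.closed_simps)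
    then have "\<exists>N. \<forall>i\<ge>N. \<forall>j\<ge>N. hdist T' (s' i) (s' j) < e" if "e > 0" for e
      using T.hdist_Cauchy[OF cl(1) z s(2) that] by simp
    then show ?thesis using T'.complete[of s'] cl s s' unfolding lim_def by blast
  qed
  have lim_ip: "ip T' z' w' = ip T z w"
    if "z \<in> hcar T" "z' \<in> hcar T'" "w \<in> hcar T" "w' \<in> hcar T'" "lim z z' s s'" "lim w w' r r'"
    for z z' w w' s s' r r'
  proof -
    have "s n \<in> hcar T" "s' n \<in> hcar T'" "r n \<in> hcar T" "r' n \<in> hcar T'" for n
      using that(5,6) G unfolding lim_def by blast+
    then have "(\<lambda>n. ip T (s n) (r n)) \<longlonglongrightarrow> ip T z w" "(\<lambda>n. ip T' (s' n) (r' n)) \<longlonglongrightarrow> ip T' z' w'"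
      using that unfolding lim_def by (auto intro!: T.tendsto_ip T'.tendsto_ip)
    moreover have "ip T' (s' n) (r' n) = ip T (s n) (r n)" for n
      using that(5,6) ip unfolding lim_def by blast
    ultimately show ?thesis by (simp add: LIMSEQ_unique)
  qed
  define f where "f z = (SOME z'. z' \<in> hcar T' \<and> (\<exists>s s'. lim z z' s s'))" for z
  have f: "f z \<in> hcar T' \<and> (\<exists>s s'. lim z (f z) s s')" if "z \<in> hcar T" for z
    unfolding f_def by (rule someI_ex[OF ex[OF that]])
  have "ip_preserving T T' f"
    unfolding ip_preserving_def using f lim_ip by meson
  moreover have "f z = z'" if zG: "(z, z') \<in> G" for z z'
  proof -
    have z: "z \<in> hcar T" "z' \<in> hcar T'" using G zG by auto
    have "lim z z' (\<lambda>_. z) (\<lambda>_. z')"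
      unfolding lim_def using zG z by (simp add: T.hdist_self T'.hdist_self)
    then show ?thesis
      using z f[OF z(1)] lim_ip by (intro T'.eq_by_ip) metis+
  qed
  ultimately show ?thesis by blast
qed

text \<open>The remainder \<open>b F\<close> after finitely many terms is a sesquilinear form. Its
  positivity passes from \<open>S\<close> to the closure by continuity, and then a parallelogram law
  bounds the remainder at \<open>x\<close> by those at a nearby \<open>y\<close> and at the
  difference.\<close>

lemma parseval_on_dense:
  assumes Z: "hilbert_module Z" and f: "\<And>i. i \<in> I \<Longrightarrow> f i \<in> hcar Z"
    and S: "hdense Z S"
    and sum: "\<And>x. x \<in> S \<Longrightarrow> ((\<lambda>i. ip Z x (f i) * ip Z (f i) x) has_sum ip Z x x) I"
    and x: "x \<in> hcar Z"
  shows "((\<lambda>i. ip Z x (f i) * ip Z (f i) x) has_sum ip Z x x) I"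
proof -
  interpret Z: hilbert_module Z by (rule Z)
  have pos: "positive (ip Z y (f i) * ip Z (f i) y)" if "i \<in> I" "y \<in> hcar Z" for i y
    using Z.ip_star[of "f i" y] f[OF that(1)] that(2) by (simp add: positive_star_mult_self)
  have SZ: "S \<subseteq> hcar Z" using S by (simp add: hdense_def)
  define b where "b F y z = ip Z y z - (\<Sum>i\<in>F. ip Z y (f i) * ip Z (f i) z)" for F y z
  note iff = has_sum_positive_iff[where I=I and g="\<lambda>i. ip Z y (f i) * ip Z (f i) y" and h="ip Z y y" for y]
  have b_pos: "positive (b F y y)" if F: "finite F" "F \<subseteq> I" and y: "y \<in> hcar Z" for F y
  proof -
    obtain s where s: "\<And>n. s n \<in> S" "(\<lambda>n. hdist Z (s n) y) \<longlonglongrightarrow> 0"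
      using Z.hdense_sequence[OF S y] by blast
    have "positive (b F (s n) (s n))" for n
      using iff[of "s n"] sum[OF s(1)] pos SZ s(1) F unfolding b_def by blast
    moreover have "(\<lambda>n. b F (s n) (s n)) \<longlonglongrightarrow> b F y y"
      unfolding b_def using F s SZ f y
      by (intro tendsto_intros Z.tendsto_ip Z.tendsto_ip_const) (auto simp: subset_iff)
    ultimately show ?thesis by (rule positive_LIMSEQ)
  qed
  have approx: "\<exists>F. finite F \<and> F \<subseteq> I \<and> norm (b F x x) < e" if e: "e > 0" for e
  proof -
    \<comment> \<open>The parallelogram law counts the remainders at \<open>y\<close> and at
      \<open>d\<close> twice each; four contributions below \<open>e / 4\<close> stay below
      \<open>e\<close>.\<close>
    obtain y where y: "y \<in> S" "hdist Z x y < sqrt (e / 4)"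
      using S x e unfolding hdense_def by (meson real_sqrt_gt_zero zero_less_divide_iff zero_less_numeral)
    have yZ: "y \<in> hcar Z" using y SZ by blast
    obtain F where F: "finite F" "F \<subseteq> I" "norm (b F y y) < e / 4"
    proof -
      have "e / 4 > 0" using e by simp
      then show thesis
        using that iff[of y] sum[OF y(1)] pos[OF _ yZ] unfolding b_def by blast
    qed
    define d where "d = hminus Z x y"
    have d: "d \<in> hcar Z" using x yZ by (simp add: d_def Z.hminus_closed)
    have bl: "b F (hminus Z u v) w = b F u w - b F v w" "b F w (hminus Z u v) = b F w u - b F w v"
      if "u \<in> hcar Z" "v \<in> hcar Z" "w \<in> hcar Z" for u v w
      using that F f by (simp_all add: b_def Z.ip_simps subset_iff left_diff_distrib right_diff_distrib sum_subtractf)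
    \<comment> \<open>Parallelogram law for \<open>b F\<close>, with \<open>x = y + d\<close>.
      Dropping the positive left side leaves an upper bound for \<open>b F x x\<close>.\<close>
    have "b F (hminus Z y d) (hminus Z y d) = (b F y y + b F y y) + (b F d d + b F d d) - b F x x"
      using x yZ d by (simp add: bl Z.hminus_closed) (simp add: d_def bl x yZ Z.hminus_closed)
    then have "norm (b F x x) \<le> norm ((b F y y + b F y y) + (b F d d + b F d d))"
      using b_pos[of F "hminus Z y d"] b_pos[of F x] F x yZ d
      by (intro positive_norm_mono) (simp_all add: Z.hminus_closed)
    also have "\<dots> \<le> (norm (b F y y) + norm (b F y y)) + (norm (b F d d) + norm (b F d d))"
      by (intro order_trans[OF norm_triangle_ineq] add_mono norm_triangle_ineq)
    also have "norm (b F d d) \<le> norm (ip Z d d)"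
    proof (rule positive_norm_mono[OF b_pos[OF F(1,2) d]])
      show "positive (ip Z d d - b F d d)"
        using F pos d by (auto simp: b_def intro!: positive_sum)
    qed
    also have "norm (ip Z d d) < e / 4"
      using y(2) by (simp add: hdist_eq_hnorm hnorm_def d_def)
    finally show ?thesis using F by (intro exI[of _ F]) auto
  qed
  show ?thesis
    using iff[of x] pos x b_pos approx unfolding b_def by blast
qed

section \<open>Internal tensor products\<close>

lemma (in hilbert_module) hspan_closed: "S \<subseteq> hcar X \<Longrightarrow> x \<in> hspan X S \<Longrightarrow> x \<in> hcar X"
  by (rotate_tac, induction rule: hspan.induct) (auto simp: closed_simps)

lemma hdense_hspanI:
  assumes "hdense X (hspan X S)" "hspan X S \<subseteq> D" "D \<subseteq> hcar X" shows "hdense X D"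
  using assms unfolding hdense_def by blast

context correspondence
begin

text \<open>Write \<open>(norm a)\<^sup>2 - star a * a = star c * c\<close> and apply the action to
  \<open>y\<close>. As the action need not be unital, the left side involves
  \<open>e = 1 \<cdot> y\<close>; the action of 1 is a projection, so
  \<open>ip M y e \<le> ip M y y\<close>.\<close>

lemma hnorm_lact:
  assumes y: "y \<in> hcar M" shows "hnorm M (lact M a y) \<le> norm a * hnorm M y"
proof (rule power2_le_imp_le)
  define r where "r = (norm a)\<^sup>2"
  define e where "e = lact M 1 y"
  have e: "e \<in> hcar M" using y by (simp add: e_def lact_closed)
  have ee: "ip M e e = ip M y e" "ip M e y = ip M y e"
    using y lact_adjoint[of y e 1] lact_adjoint[of y y 1]
    by (simp_all add: e_def star_one lact_closed flip: lact_mult)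
  have "positive (ip M (hminus M y e) (hminus M y e))"
    by (intro ip_positive hminus_closed y e)
  then have p1: "positive (ip M y y - ip M y e)"
    using y e by (simp add: ip_simps closed_simps ee)
  have "positive (r *\<^sub>R 1 - star a * a)"
    using positive_norm_diff[of "star a * a"] by (simp add: star_mult star_star cstar_identity r_def)
  then obtain c where "r *\<^sub>R 1 - star a * a = star c * c" unfolding positive_def by blast
  then have r1: "scaleC (complex_of_real r) 1 = star a * a + star c * c"
    by (simp add: scaleC_of_real algebra_simps)
  have sq: "ip M y (lact M (star b * b) y) = ip M (lact M b y) (lact M b y)" for b
    using y lact_adjoint[of y "lact M b y" b] by (simp add: lact_mult lact_closed)
  have "r *\<^sub>R ip M y e = ip M y (lact M (scaleC (complex_of_real r) 1) y)"
    using y e by (simp add: lact_scaleC e_def[symmetric] ip_simps) (simp add: scaleC_of_real)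
  also have "\<dots> = ip M (lact M a y) (lact M a y) + ip M (lact M c y) (lact M c y)"
    unfolding r1 using y by (simp add: lact_add_left ip_simps lact_closed sq)
  finally have re: "r *\<^sub>R ip M y e = ip M (lact M a y) (lact M a y) + ip M (lact M c y) (lact M c y)" .
  have "positive (r *\<^sub>R (ip M y y - ip M y e) + ip M (lact M c y) (lact M c y))"
    using y p1 by (intro positive_add positive_scaleR ip_positive lact_closed) (auto simp: r_def)
  then have "positive (r *\<^sub>R ip M y y - ip M (lact M a y) (lact M a y))"
    by (simp add: scaleR_diff_right re)
  then have "norm (ip M (lact M a y) (lact M a y)) \<le> norm (r *\<^sub>R ip M y y)"
    using y by (intro positive_norm_mono ip_positive lact_closed)
  then show "(hnorm M (lact M a y))\<^sup>2 \<le> (norm a * hnorm M y)\<^sup>2"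
    by (simp add: hnorm_power2 power_mult_distrib r_def)
qed simp

text \<open>This lets a norm convergent sum in the algebra pass through the left action.\<close>

lemma bounded_linear_ip_lact:
  assumes "x \<in> hcar M" "y \<in> hcar M"
  shows "bounded_linear (\<lambda>a. ip M x (lact M a y))"
proof (rule bounded_linear_intro[where K="hnorm M x * hnorm M y"])
  show "ip M x (lact M (r *\<^sub>R a) y) = r *\<^sub>R ip M x (lact M a y)" for r a
    using assms lact_scaleC[of y "complex_of_real r" a]
    by (simp add: scaleC_of_real ip_simps lact_closed)
  show "norm (ip M x (lact M a y)) \<le> norm a * (hnorm M x * hnorm M y)" for a
    using order_trans[OF cauchy_schwarz mult_left_mono[OF hnorm_lact]] assms
    by (simp add: lact_closed algebra_simps)
qed (simp add: assms lact_add_left ip_simps lact_closed)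

lemma lact_zero: "y \<in> hcar M \<Longrightarrow> lact M 0 y = hzero M"
  using bounded_linear.linear[OF bounded_linear_ip_lact] linear_0
  by (intro ext_ip) (force simp: lact_closed ip_simps zero_closed)+

end

locale tensor_product =
  fixes Y :: "('y, 'a::unital_cstar_algebra, 'z) hmod_scheme" and N :: "('n, 'a, 'w) corr_scheme"
    and T :: "('t, 'a, 'v) hmod_scheme" and t :: "'y \<Rightarrow> 'n \<Rightarrow> 't"
  assumes internal_tensor: "internal_tensor Y N T t"
begin

sublocale Y: hilbert_module Y using internal_tensor by (simp add: internal_tensor_def)
sublocale N: correspondence N using internal_tensor by (simp add: internal_tensor_def)
sublocale T: hilbert_module T using internal_tensor by (simp add: internal_tensor_def)

abbreviation tensors :: "'t set" where
  "tensors \<equiv> {t y n | y n. y \<in> hcar Y \<and> n \<in> hcar N}"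

lemma
  shows t_closed: "y \<in> hcar Y \<Longrightarrow> n \<in> hcar N \<Longrightarrow> t y n \<in> hcar T"
    and t_add_right: "y \<in> hcar Y \<Longrightarrow> n \<in> hcar N \<Longrightarrow> n' \<in> hcar N \<Longrightarrow> t y (hadd N n n') = hadd T (t y n) (t y n')"
    and t_ract_right: "y \<in> hcar Y \<Longrightarrow> n \<in> hcar N \<Longrightarrow> t y (ract N n a) = ract T (t y n) a"
    and ip_t: "y \<in> hcar Y \<Longrightarrow> y' \<in> hcar Y \<Longrightarrow> n \<in> hcar N \<Longrightarrow> n' \<in> hcar N \<Longrightarrow>
        ip T (t y n) (t y' n') = ip N n (lact N (ip Y y y') n')"
    and dense: "hdense T (hspan T tensors)"
  using internal_tensor by (simp_all add: internal_tensor_def)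

lemma t_zero_right: "y \<in> hcar Y \<Longrightarrow> t y (hzero N) = hzero T"
  by (rule T.eq_by_ip) (simp_all add: ip_t T.ip_simps N.ip_simps N.closed_simps T.closed_simps t_closed N.lact_closed)

lemma hspan_tensors_closed: "x \<in> hspan T tensors \<Longrightarrow> x \<in> hcar T"
  by (rule T.hspan_closed) (auto simp: t_closed)

end

text \<open>
  The graph of \<open>S \<otimes> id\<close> on the algebraic tensor product is the span of the pairs
  \<open>(y \<otimes> n, S y \<otimes> n)\<close> in the product module, of which only the operations matter.
\<close>

lemma
  fixes Y :: "('y, 'a::unital_cstar_algebra, 'z1) hmod_scheme" and N :: "('n, 'a, 'z2) corr_scheme"
    and T :: "('t, 'a, 'z3) hmod_scheme" and T' :: "('s, 'a, 'z4) hmod_scheme"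
    and Y' :: "('w, 'a, 'z5) hmod_scheme"
  assumes T: "internal_tensor Y N T t" and T': "internal_tensor Y' N T' t'"
    and S: "ip_preserving Y Y' S"
  shows ip_preserving_tensor_id: "ip_preserving T T' (tensor_id Y N T t T' t' S)"
    and tensor_id_apply:
      "y \<in> hcar Y \<Longrightarrow> n \<in> hcar N \<Longrightarrow> tensor_id Y N T t T' t' S (t y n) = t' (S y) n"
proof -
  interpret T: tensor_product Y N T t by standard (rule T)
  interpret T': tensor_product Y' N T' t' by standard (rule T')
  define TT :: "('t \<times> 's, 'a) hmod" where "TT = \<lparr>hcar = UNIV,
    hadd = (\<lambda>(x, x') (y, y'). (hadd T x y, hadd T' x' y')), hzero = (hzero T, hzero T'),
    ract = (\<lambda>(x, x') a. (ract T x a, ract T' x' a)), ip = (\<lambda>_ _. 0)\<rparr>"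
  define B where "B = {(t y n, t' (S y) n) | y n. y \<in> hcar Y \<and> n \<in> hcar N}"
  define G where "G = hspan TT B"
  have SY: "S y \<in> hcar Y'" if "y \<in> hcar Y" for y using S that by (rule ip_preserving_closed)
  have G_closed: "fst p \<in> hcar T \<and> snd p \<in> hcar T'" if "p \<in> G" for p
    using that unfolding G_def
    by induction (auto simp: TT_def B_def T.T.closed_simps T'.T.closed_simps T.t_closed T'.t_closed SY split: prod.splits)
  \<comment> \<open>Sesquilinearity is used one slot at a time: here one entry is a generator, and a
    second induction frees it.\<close>
  have G_ip_B: "ip T' (snd p) (t' (S y) n) = ip T (fst p) (t y n)"
    if "p \<in> G" "y \<in> hcar Y" "n \<in> hcar N" for p y n
    using that(1) unfolding G_def
  proof induction
    case (hspan_base p)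
    then show ?case
      using that(2,3) by (auto simp: B_def T.ip_t T'.ip_t SY ip_preserving_ip[OF S])
  next
    case (hspan_add p q)
    then show ?case
      using that(2,3) G_closed[of p] G_closed[of q]
      by (auto simp: G_def TT_def T.T.ip_simps T'.T.ip_simps T.t_closed T'.t_closed SY split: prod.splits)
  next
    case (hspan_ract p a)
    then show ?case
      using that(2,3) G_closed[of p]
      by (auto simp: G_def TT_def T.T.ip_simps T'.T.ip_simps T.t_closed T'.t_closed SY split: prod.splits)
  qed (simp add: TT_def that(2,3) T.T.ip_simps T'.T.ip_simps T.t_closed T'.t_closed SY)
  have G_ip: "ip T' (snd q) (snd p) = ip T (fst q) (fst p)" if "p \<in> G" "q \<in> G" for p q
    using that(1) unfolding G_def
  proof induction
    case (hspan_base p)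
    then show ?case using G_ip_B[OF that(2)] by (auto simp: B_def)
  next
    case (hspan_add p p')
    then show ?case
      using G_closed[OF that(2)] G_closed[of p] G_closed[of p']
      by (auto simp: G_def TT_def T.T.ip_simps T'.T.ip_simps split: prod.splits)
  next
    case (hspan_ract p a)
    then show ?case
      using G_closed[OF that(2)] G_closed[of p]
      by (auto simp: G_def TT_def T.T.ip_simps T'.T.ip_simps split: prod.splits)
  qed (use G_closed[OF that(2)] in \<open>simp add: TT_def T.T.ip_simps T'.T.ip_simps\<close>)
  have "\<exists>z'. (z, z') \<in> G" if "z \<in> hspan T T.tensors" for z
    using that
  proof induction
    case hspan_zero
    then show ?case using hspan.hspan_zero[of TT B] by (auto simp: G_def TT_def)
  next
    case (hspan_base z)
    then obtain y n where "z = t y n" "y \<in> hcar Y" "n \<in> hcar N" by blast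
    then have "(z, t' (S y) n) \<in> B" by (auto simp: B_def)
    then show ?case unfolding G_def by (blast intro: hspan.hspan_base)
  next
    case (hspan_add z w)
    then obtain z' w' where "(z, z') \<in> G" "(w, w') \<in> G" by blast
    then show ?case using hspan.hspan_add[of "(z, z')" TT B "(w, w')"] by (auto simp: G_def TT_def)
  next
    case (hspan_ract z a)
    then obtain z' where "(z, z') \<in> G" by blast
    then show ?case using hspan.hspan_ract[of "(z, z')" TT B a] by (auto simp: G_def TT_def)
  qed
  then have "hdense T (Domain G)"
    using G_closed by (intro hdense_hspanI[OF T.dense]) force+
  then obtain f where f: "ip_preserving T T' f" "\<forall>(z, z')\<in>G. f z = z'"
    using G_closed G_ip
      isometric_relation_extends[OF T.T.hilbert_module_axioms T'.T.hilbert_module_axioms, of G]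
    by force
  have "(t y n, t' (S y) n) \<in> G" if "y \<in> hcar Y" "n \<in> hcar N" for y n
    unfolding G_def using that by (intro hspan.hspan_base) (auto simp: B_def)
  then have ex: "\<exists>f. ip_preserving T T' f \<and> (\<forall>y\<in>hcar Y. \<forall>n\<in>hcar N. f (t y n) = t' (S y) n)"
    using f by (intro exI[of _ f]) (use case_prodD in fastforce)
  show "ip_preserving T T' (tensor_id Y N T t T' t' S)"
    "y \<in> hcar Y \<Longrightarrow> n \<in> hcar N \<Longrightarrow> tensor_id Y N T t T' t' S (t y n) = t' (S y) n"
    using someI_ex[OF ex] unfolding tensor_id_def by blast+
qed

section \<open>Polarization and frames of tensor products\<close>

lemma has_sum_eqI:
  "(f has_sum a) A \<Longrightarrow> (\<And>x. x \<in> A \<Longrightarrow> f x = g x) \<Longrightarrow> a = b \<Longrightarrow> (g has_sum b) A"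
  using has_sum_cong by metis

lemma has_sum_diff:
  fixes f g :: "'i \<Rightarrow> 'a::topological_ab_group_add"
  assumes "(f has_sum a) A" "(g has_sum b) A"
  shows "((\<lambda>i. f i - g i) has_sum (a - b)) A"
  using has_sum_add[OF assms(1), of "\<lambda>i. - g i" "- b"] assms(2) by (simp add: has_sum_uminus)

text \<open>The two brackets are \<open>xy + yx\<close> and \<open>\<i> (xy - yx)\<close>, which
  come from \<open>x + y\<close> and \<open>x + y \<cdot> \<i>\<close>. Stated for algebra elements,
  it applies both to inner products and to the single terms of a Parseval series.\<close>

lemma polarization:
  fixes xx yy xy yx :: "'a::unital_cstar_algebra"
  shows "(1/2) *\<^sub>R (((xx + xy + yx + yy) - xx - yy)
    + scaleC (- \<i>) ((xx + scaleC \<i> xy - scaleC \<i> yx + yy) - xx - yy)) = xy"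
proof -
  have "((xx + xy + yx + yy) - xx - yy)
      + scaleC (- \<i>) ((xx + scaleC \<i> xy - scaleC \<i> yx + yy) - xx - yy) = 2 *\<^sub>R xy"
    by (simp add: scaleC_minus_left scaleC_diff_right scaleC_i_i scaleR_2)
  then show ?thesis by simp
qed

lemma parseval_frame_polarized:
  fixes Z :: "('x, 'a::unital_cstar_algebra, 'z) hmod_scheme"
  assumes frame: "parseval_frame Z J f" and xy: "x \<in> hcar Z" "y \<in> hcar Z"
  shows "((\<lambda>j. ip Z x (f j) * ip Z (f j) y) has_sum ip Z x y) J"
proof -
  interpret hilbert_module Z using frame by (simp add: parseval_frame_def)
  have f: "f j \<in> hcar Z" if "j \<in> J" for j using frame that by (simp add: parseval_frame_def)
  have sum: "((\<lambda>j. ip Z z (f j) * ip Z (f j) z) has_sum ip Z z z) J" if "z \<in> hcar Z" for z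
    using frame that by (simp add: parseval_frame_def)
  define q where "q z j = ip Z z (f j) * ip Z (f j) z" for z j
  \<comment> \<open>Multiplication of \<open>y\<close> by the imaginary unit, expressed through the
    right action.\<close>
  define y' where "y' = ract Z y (scaleC \<i> 1)"
  have y': "y' \<in> hcar Z" using xy by (simp add: y'_def ract_closed)
  have "((\<lambda>j. (1/2) *\<^sub>R ((q (hadd Z x y) j - q x j - q y j)
      + scaleC (- \<i>) (q (hadd Z x y') j - q x j - q y' j))) has_sum
      (1/2) *\<^sub>R ((ip Z (hadd Z x y) (hadd Z x y) - ip Z x x - ip Z y y)
      + scaleC (- \<i>) (ip Z (hadd Z x y') (hadd Z x y') - ip Z x x - ip Z y' y'))) J"
    unfolding q_def using xy y'
    by (intro has_sum_scaleR has_sum_add has_sum_diff sum add_closed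
        has_sum_bounded_linear[OF bounded_linear_scaleC])
  also have "(1/2) *\<^sub>R ((ip Z (hadd Z x y) (hadd Z x y) - ip Z x x - ip Z y y)
      + scaleC (- \<i>) (ip Z (hadd Z x y') (hadd Z x y') - ip Z x x - ip Z y' y')) = ip Z x y"
    using polarization[of "ip Z x x" "ip Z x y" "ip Z y x" "ip Z y y"] xy y'
    by (simp add: ip_simps add_closed)
       (simp add: y'_def ip_simps mult_scaleC_left mult_scaleC_right star_scaleC_i star_one algebra_simps)
  finally show ?thesis
  proof (rule has_sum_eqI)
    fix j assume "j \<in> J"
    then have fj: "f j \<in> hcar Z" by (rule f)
    show "(1/2) *\<^sub>R ((q (hadd Z x y) j - q x j - q y j)
      + scaleC (- \<i>) (q (hadd Z x y') j - q x j - q y' j)) = ip Z x (f j) * ip Z (f j) y"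
      using polarization[of "q x j" "ip Z x (f j) * ip Z (f j) y" "ip Z y (f j) * ip Z (f j) x" "q y j"]
        xy y' fj
      by (simp add: q_def ip_simps add_closed)
         (simp add: y'_def ip_simps mult_scaleC_left mult_scaleC_right star_scaleC_i star_one
           scaleC_minus_left scaleC_diff_right scaleC_minus_right scaleC_i_i algebra_simps)
  qed simp
qed

context tensor_product
begin

text \<open>
  The family \<open>v\<close> consists of the values at \<open>x\<close> of the adjoints of the maps \<open>n \<mapsto> m j \<otimes> n\<close>.
\<close>

lemma adjoint_family:
  assumes m: "parseval_frame Y J m" and x: "x \<in> hspan T tensors"
  shows "\<exists>v. (\<forall>j\<in>J. v j \<in> hcar N \<and> (\<forall>n\<in>hcar N. ip T (t (m j) n) x = ip N n (v j))) \<and>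
    (\<forall>z\<in>hspan T tensors. ((\<lambda>j. ip T z (t (m j) (v j))) has_sum ip T z x) J)"
proof -
  have mY: "m j \<in> hcar Y" if "j \<in> J" for j using m that by (simp add: parseval_frame_def)
  note sp = hspan_tensors_closed
  \<comment> \<open>On an elementary tensor the adjoint is explicit: it sends
    \<open>y \<otimes> n\<close> to \<open>\<langle>m j, y\<rangle> \<cdot> n\<close>. The sum over
    \<open>j\<close> is the polarized frame identity of \<open>Y\<close>, carried through the left
    action on \<open>n\<close>.\<close>
  have base: "((\<lambda>j. ip T z (t (m j) (lact N (ip Y (m j) y) n))) has_sum ip T z (t y n)) J"
    if z: "z \<in> hspan T tensors" and y: "y \<in> hcar Y" and n: "n \<in> hcar N" for z y n
    using z
  proof induction
    case hspan_zero
    show ?case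
      by (rule has_sum_eqI[OF has_sum_0]) (simp_all add: T.ip_simps t_closed mY y n N.lact_closed)
  next
    case (hspan_base z)
    then obtain y0 n0 where z: "z = t y0 n0" and yn0: "y0 \<in> hcar Y" "n0 \<in> hcar N" by blast
    have "((\<lambda>j. ip N n0 (lact N (ip Y y0 (m j) * ip Y (m j) y) n)) has_sum ip N n0 (lact N (ip Y y0 y) n)) J"
      using has_sum_bounded_linear[OF N.bounded_linear_ip_lact parseval_frame_polarized[OF m], OF yn0(2) n yn0(1) y]
      by (simp add: o_def)
    then show ?case
      by (rule has_sum_eqI) (simp_all add: z yn0 ip_t mY y n N.lact_closed N.lact_mult)
  next
    case (hspan_add z w)
    show ?case
      by (rule has_sum_eqI[OF has_sum_add[OF hspan_add.IH]])
         (simp_all add: T.ip_simps t_closed mY y n N.lact_closed sp hspan_add)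
  next
    case (hspan_ract z a)
    show ?case
      by (rule has_sum_eqI[OF has_sum_cmult_right[OF hspan_ract.IH, of "star a"]])
         (simp_all add: T.ip_simps t_closed mY y n N.lact_closed sp hspan_ract)
  qed
  show ?thesis
    using x
  proof induction
    case hspan_zero
    show ?case
      by (intro exI[of _ "\<lambda>_. hzero N"] conjI ballI)
         (auto simp: N.ip_simps T.ip_simps N.closed_simps t_closed mY sp t_zero_right
           intro!: has_sum_eqI[OF has_sum_0])
  next
    case (hspan_base x)
    then obtain y n where x: "x = t y n" and yn: "y \<in> hcar Y" "n \<in> hcar N" by blast
    then show ?case
      by (intro exI[of _ "\<lambda>j. lact N (ip Y (m j) y) n"] conjI ballI)
         (auto simp: ip_t N.lact_closed mY base)
  next
    case (hspan_add x x')
    then obtain v v' where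
        v: "\<And>j. j \<in> J \<Longrightarrow> v j \<in> hcar N" "\<And>j n. j \<in> J \<Longrightarrow> n \<in> hcar N \<Longrightarrow> ip T (t (m j) n) x = ip N n (v j)"
          "\<And>z. z \<in> hspan T tensors \<Longrightarrow> ((\<lambda>j. ip T z (t (m j) (v j))) has_sum ip T z x) J"
      and v': "\<And>j. j \<in> J \<Longrightarrow> v' j \<in> hcar N" "\<And>j n. j \<in> J \<Longrightarrow> n \<in> hcar N \<Longrightarrow> ip T (t (m j) n) x' = ip N n (v' j)"
          "\<And>z. z \<in> hspan T tensors \<Longrightarrow> ((\<lambda>j. ip T z (t (m j) (v' j))) has_sum ip T z x') J"
      by blast
    show ?case
    proof (intro exI[of _ "\<lambda>j. hadd N (v j) (v' j)"] conjI ballI)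
      fix z assume z: "z \<in> hspan T tensors"
      show "((\<lambda>j. ip T z (t (m j) (hadd N (v j) (v' j)))) has_sum ip T z (hadd T x x')) J"
        by (rule has_sum_eqI[OF has_sum_add[OF v(3)[OF z] v'(3)[OF z]]])
           (simp_all add: t_add_right T.ip_simps t_closed mY v(1) v'(1) sp z hspan_add.hyps)
    qed (simp_all add: N.closed_simps N.ip_simps T.ip_simps v(1,2) v'(1,2) t_closed mY sp hspan_add.hyps)
  next
    case (hspan_ract x a)
    then obtain v where
        v: "\<And>j. j \<in> J \<Longrightarrow> v j \<in> hcar N" "\<And>j n. j \<in> J \<Longrightarrow> n \<in> hcar N \<Longrightarrow> ip T (t (m j) n) x = ip N n (v j)"
          "\<And>z. z \<in> hspan T tensors \<Longrightarrow> ((\<lambda>j. ip T z (t (m j) (v j))) has_sum ip T z x) J"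
      by blast
    show ?case
    proof (intro exI[of _ "\<lambda>j. ract N (v j) a"] conjI ballI)
      fix z assume z: "z \<in> hspan T tensors"
      show "((\<lambda>j. ip T z (t (m j) (ract N (v j) a))) has_sum ip T z (ract T x a)) J"
        by (rule has_sum_eqI[OF has_sum_cmult_left[OF v(3)[OF z], of a]])
           (simp_all add: t_ract_right T.ip_simps t_closed mY v(1) sp z hspan_ract.hyps)
    qed (simp_all add: N.closed_simps N.ip_simps T.ip_simps v(1,2) t_closed mY sp hspan_ract.hyps)
  qed
qed

text \<open>With the vectors \<open>v j\<close> of \<open>adjoint_family\<close>, the frame of
  \<open>N\<close> sums the terms with fixed \<open>j\<close> to
  \<open>\<langle>v j, v j\<rangle>\<close>, and these sum over \<open>j\<close> to
  \<open>\<langle>x, x\<rangle>\<close>. Positivity merges the iterated sum into a double sum, and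
  density removes the restriction to the span.\<close>

theorem parseval_frame_tensor:
  assumes m: "parseval_frame Y J m" and p: "parseval_frame N I p"
  shows "parseval_frame T (J \<times> I) (\<lambda>(j, i). t (m j) (p i))"
proof -
  have mY: "m j \<in> hcar Y" if "j \<in> J" for j using m that by (simp add: parseval_frame_def)
  have pN: "p i \<in> hcar N" if "i \<in> I" for i using p that by (simp add: parseval_frame_def)
  have on_span: "((\<lambda>k. ip T x (case k of (j, i) \<Rightarrow> t (m j) (p i)) * ip T (case k of (j, i) \<Rightarrow> t (m j) (p i)) x)
      has_sum ip T x x) (J \<times> I)" if x: "x \<in> hspan T tensors" for x
  proof -
    have xT: "x \<in> hcar T" using x by (rule hspan_tensors_closed)
    obtain v where v: "\<And>j. j \<in> J \<Longrightarrow> v j \<in> hcar N"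
        "\<And>j n. j \<in> J \<Longrightarrow> n \<in> hcar N \<Longrightarrow> ip T (t (m j) n) x = ip N n (v j)"
        "((\<lambda>j. ip T x (t (m j) (v j))) has_sum ip T x x) J"
      using adjoint_family[OF m x] x by blast
    have flip: "ip T x (t (m j) n) = ip N (v j) n" if "j \<in> J" "n \<in> hcar N" for j n
      using T.ip_star[of "t (m j) n" x] N.ip_star[of n "v j"] that v(1,2) xT t_closed mY by simp
    have "((\<lambda>(j, i). ip N (v j) (p i) * ip N (p i) (v j)) has_sum ip T x x) (J \<times> I)"
    proof (rule has_sum_Times_positive)
      show "positive (ip N (v j) (p i) * ip N (p i) (v j))" if "j \<in> J" "i \<in> I" for j i
        using N.ip_star[of "p i" "v j"] v(1) pN that by (simp add: positive_star_mult_self)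
      show "((\<lambda>i. ip N (v j) (p i) * ip N (p i) (v j)) has_sum ip N (v j) (v j)) I" if "j \<in> J" for j
        using p v(1)[OF that] by (simp add: parseval_frame_def)
      show "((\<lambda>j. ip N (v j) (v j)) has_sum ip T x x) J"
        by (rule has_sum_eqI[OF v(3)]) (simp_all add: flip v(1))
    qed
    then show ?thesis
      by (rule has_sum_eqI) (auto simp: flip v(2) pN)
  qed
  have closed: "(case k of (j, i) \<Rightarrow> t (m j) (p i)) \<in> hcar T" if "k \<in> J \<times> I" for k
    using that by (auto simp: t_closed mY pN)
  show ?thesis
    unfolding parseval_frame_def
    using m p T.hilbert_module_axioms closed
      parseval_on_dense[OF T.hilbert_module_axioms closed dense on_span]
    by (simp add: parseval_frame_def)
qed

end

section \<open>Tensor powers and scaling functions\<close>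

lemma hmod_isoD:
  assumes "hmod_iso X Y f"
  shows "ip_preserving X Y f" "f ` hcar X = hcar Y"
  using assms by (simp_all add: hmod_iso_def)

lemma parseval_frame_iso:
  assumes frame: "parseval_frame X J f" and Y: "hilbert_module Y" and g: "hmod_iso X Y g"
  shows "parseval_frame Y J (g \<circ> f)"
proof -
  have f: "f j \<in> hcar X" if "j \<in> J" for j using frame that by (simp add: parseval_frame_def)
  have "((\<lambda>j. ip Y y ((g \<circ> f) j) * ip Y ((g \<circ> f) j) y) has_sum ip Y y y) J" if "y \<in> hcar Y" for y
  proof -
    have "y \<in> g ` hcar X" using that by (simp add: hmod_isoD(2)[OF g])
    then obtain x where x: "x \<in> hcar X" "y = g x" by blast
    then have "((\<lambda>j. ip X x (f j) * ip X (f j) x) has_sum ip X x x) J"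
      using frame by (simp add: parseval_frame_def)
    then show ?thesis
      by (rule has_sum_eqI) (simp_all add: x ip_preserving_ip[OF hmod_isoD(1)[OF g]] f)
  qed
  then show ?thesis
    using frame Y ip_preserving_closed[OF hmod_isoD(1)[OF g]] by (simp add: parseval_frame_def)
qed

lemma parseval_frame_reindex:
  assumes "parseval_frame X J f" and h: "bij_betw h I J" and g: "\<And>i. i \<in> I \<Longrightarrow> f (h i) = g i"
  shows "parseval_frame X I g"
proof -
  have "((\<lambda>i. ip X x (g i) * ip X (g i) x) has_sum ip X x x) I" if "x \<in> hcar X" for x
  proof (rule has_sum_eqI)
    show "((\<lambda>i. ip X x (f (h i)) * ip X (f (h i)) x) has_sum ip X x x) I"
      using has_sum_reindex_bij_betw[OF h, of "\<lambda>j. ip X x (f j) * ip X (f j) x"] assms(1) that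
      by (simp add: parseval_frame_def)
  qed (simp_all add: g)
  then show ?thesis
    using assms(1) bij_betwE[OF h] countableI_bij2[OF h] g[symmetric] by (simp add: parseval_frame_def)
qed

text \<open>
  For an orthonormal family the remainder \<open>\<langle>x, x\<rangle> - \<Sum> \<langle>x, f i\<rangle> \<langle>f i, x\<rangle>\<close> is the square of the
  distance from \<open>x\<close> to \<open>\<Sum> f i \<langle>f i, x\<rangle>\<close>.
\<close>

lemma orthonormal_basis_of_parseval_frame:
  fixes Z :: "('x, 'a::unital_cstar_algebra, 'z) hmod_scheme"
  assumes frame: "parseval_frame Z I f"
    and on: "\<And>i j. i \<in> I \<Longrightarrow> j \<in> I \<Longrightarrow> ip Z (f i) (f j) = (if i = j then 1 else 0)"
  shows "orthonormal_basis Z I f"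
proof -
  interpret hilbert_module Z using frame by (simp add: parseval_frame_def)
  have f: "f i \<in> hcar Z" if "i \<in> I" for i using frame that by (simp add: parseval_frame_def)
  have span: "x \<in> hcar Z" if "x \<in> hspan Z (f ` I)" for x
    by (rule hspan_closed[OF _ that]) (use f in auto)
  \<comment> \<open>The finite sum of the vectors
    \<open>f i \<cdot> \<langle>f i, x\<rangle>\<close> is built by induction in the span and
    described only through its inner products.\<close>
  have ex: "\<exists>y\<in>hspan Z (f ` I). \<forall>w\<in>hcar Z. ip Z w y = (\<Sum>i\<in>F. ip Z w (f i) * ip Z (f i) x)"
    if "finite F" "F \<subseteq> I" "x \<in> hcar Z" for F x
    using that(1,2)
  proof induction
    case empty
    show ?case by (rule bexI[OF _ hspan_zero]) (simp add: ip_simps)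
  next
    case (insert i F)
    then obtain y where y: "y \<in> hspan Z (f ` I)"
        "\<And>w. w \<in> hcar Z \<Longrightarrow> ip Z w y = (\<Sum>i\<in>F. ip Z w (f i) * ip Z (f i) x)" by auto
    have "hadd Z (ract Z (f i) (ip Z (f i) x)) y \<in> hspan Z (f ` I)"
      using insert.prems y(1) by (intro hspan_add hspan_ract) (auto intro: hspan_base)
    then show ?case
      using insert y(2) f span[OF y(1)] by (intro bexI) (auto simp: ip_simps closed_simps)
  qed
  have "\<exists>y\<in>hspan Z (f ` I). hdist Z x y < e" if x: "x \<in> hcar Z" and e: "e > 0" for x e
  proof -
    have pos: "positive (ip Z x (f i) * ip Z (f i) x)" if "i \<in> I" for i
      using ip_star[of "f i" x] f[OF that] x by (simp add: positive_star_mult_self)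
    have "((\<lambda>i. ip Z x (f i) * ip Z (f i) x) has_sum ip Z x x) I"
      using frame x by (simp add: parseval_frame_def)
    from iffD1[OF has_sum_positive_iff[OF pos] this, THEN conjunct2]
    have "\<exists>F. finite F \<and> F \<subseteq> I \<and> norm (ip Z x x - (\<Sum>i\<in>F. ip Z x (f i) * ip Z (f i) x)) < e\<^sup>2"
      using e by simp
    then obtain F where F: "finite F" "F \<subseteq> I"
        "norm (ip Z x x - (\<Sum>i\<in>F. ip Z x (f i) * ip Z (f i) x)) < e\<^sup>2"
      by blast
    obtain y where y: "y \<in> hspan Z (f ` I)"
        "\<And>w. w \<in> hcar Z \<Longrightarrow> ip Z w y = (\<Sum>i\<in>F. ip Z w (f i) * ip Z (f i) x)"
      using ex[OF F(1,2) x] by blast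
    have yZ: "y \<in> hcar Z" using y(1) by (rule span)
    have fy: "ip Z (f i) y = ip Z (f i) x" if "i \<in> F" for i
    proof -
      have "ip Z (f i) y = (\<Sum>j\<in>F. (if i = j then 1 else 0) * ip Z (f j) x)"
        using that F(2) f by (subst y(2)) (auto simp: on subset_iff intro!: sum.cong)
      also have "\<dots> = (\<Sum>j\<in>F. if i = j then ip Z (f j) x else 0)" by (intro sum.cong) auto
      finally show ?thesis using that F(1) by simp
    qed
    have yf: "ip Z y (f i) = ip Z x (f i)" if "i \<in> F" for i
      using fy[OF that] ip_star[of "f i" y] ip_star[of "f i" x] F(2) f that x yZ by auto
    have yy: "ip Z y y = ip Z x y"
      using y(2)[OF x] y(2)[OF yZ] yf by simp
    have "ip Z y x = ip Z y y"
      using ip_star[of x y] yy ip_star[of y y] x yZ by simp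
    then have "ip Z (hminus Z x y) (hminus Z x y) = ip Z x x - (\<Sum>i\<in>F. ip Z x (f i) * ip Z (f i) x)"
      using x yZ yy y(2)[OF x] by (simp add: ip_simps closed_simps)
    then have "hdist Z x y < e"
      using F(3) e by (simp add: hdist_eq_hnorm hnorm_def real_less_lsqrt)
    then show ?thesis using y(1) by blast
  qed
  then have "hdense Z (hspan Z (f ` I))"
    using span by (auto simp: hdense_def)
  then show ?thesis
    using frame on by (simp add: parseval_frame_def orthonormal_basis_def)
qed

section \<open>Index tuples and their padding by zeros\<close>

lemma countable_frame_index: "countable (frame_index J)"
  by (rule countable_subset[OF subset_UNIV]) simp

definition tuples :: "nat \<Rightarrow> nat set \<Rightarrow> nat list set" where
  "tuples k J = {js. length js = k \<and> set js \<subseteq> J}"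

text \<open>The zeros stand in front because the connecting maps of the direct limit tensor with
  \<open>m 0\<close> from the left.\<close>

definition pad :: "nat \<Rightarrow> nat list \<Rightarrow> nat list" where
  "pad k js = replicate (k - length js) 0 @ js"

lemma dropWhile_pad: "js \<in> frame_index J \<Longrightarrow> dropWhile (\<lambda>j. j = 0) (pad k js) = js"
  by (cases js) (auto simp: pad_def frame_index_def dropWhile_append)

lemma pad_dropWhile: "length js = k \<Longrightarrow> pad k (dropWhile (\<lambda>j. j = 0) js) = js"
proof (induction js arbitrary: k)
  case (Cons j js)
  show ?case
  proof (cases "j = 0")
    case True
    have "pad (length js) (dropWhile (\<lambda>j. j = 0) js) = js" using Cons.IH by simp
    moreover have "length (dropWhile (\<lambda>j. j = 0) js) \<le> length js" by (rule length_dropWhile_le)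
    ultimately show ?thesis using Cons.prems True by (auto simp: pad_def Suc_diff_le)
  qed (use Cons.prems in \<open>simp add: pad_def\<close>)
qed (simp add: pad_def)

text \<open>The condition that the first entry is positive selects the tuples without leading zeros,
  so stripping these inverts padding. The all-zero tuple corresponds to the empty list, the index of
  \<open>\<phi>\<close>.\<close>

lemma bij_betw_pad:
  assumes "0 \<in> J"
  shows "bij_betw (pad k) {js \<in> frame_index J. length js \<le> k} (tuples k J)"
proof (rule bij_betw_byWitness[where f'="dropWhile (\<lambda>j. j = 0)"])
  show "pad k ` {js \<in> frame_index J. length js \<le> k} \<subseteq> tuples k J"
    using assms by (auto simp: pad_def tuples_def frame_index_def)
  show "dropWhile (\<lambda>j. j = 0) ` tuples k J \<subseteq> {js \<in> frame_index J. length js \<le> k}"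
  proof (rule image_subsetI)
    fix js assume js: "js \<in> tuples k J"
    have "hd (dropWhile (\<lambda>j. j = 0) js) > 0" if "dropWhile (\<lambda>j. j = 0) js \<noteq> []"
      using hd_dropWhile[OF that] by simp
    then show "dropWhile (\<lambda>j. j = 0) js \<in> {js \<in> frame_index J. length js \<le> k}"
      using js length_dropWhile_le[of "\<lambda>j. j = 0" js]
      by (auto simp: tuples_def frame_index_def dest: set_dropWhileD)
  qed
qed (auto simp: dropWhile_pad pad_dropWhile tuples_def)

section \<open>Frames of the tensor powers\<close>

locale tensor_power_system =
  fixes M :: "('m, 'a::unital_cstar_algebra) corr"
    and P :: "nat \<Rightarrow> ('t, 'a) corr" and u :: "'a \<Rightarrow> 't" and v :: "'m \<Rightarrow> 't"
    and \<tau> :: "nat \<Rightarrow> nat \<Rightarrow> 't \<Rightarrow> 't \<Rightarrow> 't"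
  assumes M: "correspondence M" and essential: "essential M"
    and powers: "tensor_powers M P u v \<tau>"
begin

abbreviation el :: "'m list \<Rightarrow> 't" where "el \<equiv> elementary_tensor u v \<tau>"

lemma corr_P: "correspondence (P k)"
  using powers unfolding tensor_powers_def corr_tensor_def by (metis add_0)

sublocale M: correspondence M by (rule M)
sublocale P: correspondence "P k" for k by (rule corr_P)
sublocale PP: tensor_product "P i" "P j" "P (i + j)" "\<tau> i j" for i j
  using powers by unfold_locales (auto simp: tensor_powers_def corr_tensor_def)

lemma u_iso: "hmod_iso trivial_corr (P 0) u" "lact (P 0) a (u b) = u (a * b)"
  using powers by (simp_all add: tensor_powers_def corr_iso_def trivial_corr_def)

lemma v_iso: "hmod_iso M (P 1) v" "n \<in> hcar M \<Longrightarrow> lact (P 1) a (v n) = v (lact M a n)"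
  using powers by (simp_all add: tensor_powers_def corr_iso_def)

lemma u_closed: "u a \<in> hcar (P 0)"
  using ip_preserving_closed[OF hmod_isoD(1)[OF u_iso(1)], of a] by (simp add: trivial_corr_def)

lemma v_closed: "n \<in> hcar M \<Longrightarrow> v n \<in> hcar (P 1)"
  by (rule ip_preserving_closed[OF hmod_isoD(1)[OF v_iso(1)]])

lemma ip_u: "ip (P 0) (u a) (u b) = star a * b"
  using ip_preserving_ip[OF hmod_isoD(1)[OF u_iso(1)], of a b] by (simp add: trivial_corr_def)

lemma
  shows assoc: "p \<in> hcar (P i) \<Longrightarrow> q \<in> hcar (P j) \<Longrightarrow> r \<in> hcar (P k) \<Longrightarrow>
      \<tau> (i + j) k (\<tau> i j p q) r = \<tau> i (j + k) p (\<tau> j k q r)"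
    and unit_left: "p \<in> hcar (P k) \<Longrightarrow> \<tau> 0 k (u a) p = lact (P k) a p"
    and unit_right: "p \<in> hcar (P k) \<Longrightarrow> \<tau> k 0 p (u a) = ract (P k) p a"
    and lact_tensor: "p \<in> hcar (P i) \<Longrightarrow> q \<in> hcar (P j) \<Longrightarrow> lact (P (i + j)) a (\<tau> i j p q) = \<tau> i j (lact (P i) a p) q"
  using powers by (simp_all add: tensor_powers_def corr_tensor_def)

lemma tensor_closed: "p \<in> hcar (P i) \<Longrightarrow> q \<in> hcar (P j) \<Longrightarrow> \<tau> i j p q \<in> hcar (P (i + j))"
  by (rule PP.t_closed)

lemma el_closed: "set ns \<subseteq> hcar M \<Longrightarrow> el ns \<in> hcar (P (length ns))"
proof (induction ns)
  case (Cons n ns)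
  then show ?case using tensor_closed[of "v n" 1 "el ns" "length ns"] v_closed[of n] by simp
qed (simp add: u_closed)

text \<open>The left action reaches only the first factor, where \<open>1\<close> acts trivially
  because \<open>M\<close> is essential; for the empty tensor it is multiplication in the
  algebra.\<close>

lemma lact_one_el: "set ns \<subseteq> hcar M \<Longrightarrow> lact (P (length ns)) 1 (el ns) = el ns"
proof (cases ns)
  case (Cons n ms)
  assume "set ns \<subseteq> hcar M"
  then show ?thesis
    using lact_tensor[of "v n" 1 "el ms" "length ms" 1] v_closed[of n] v_iso(2)[of n 1] el_closed[of ms] essential
    by (simp add: Cons essential_def)
qed (simp add: u_iso(2))

text \<open>The hypothesis on \<open>R\<close> tensors with \<open>M\<close> itself, whereas the
  powers tensor with \<open>P 1\<close>; the isomorphism \<open>v\<close> carries one description to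
  the other.\<close>

lemma internal_tensor_P_M: "internal_tensor (P k) M (P (Suc k)) (\<lambda>q n. \<tau> k 1 q (v n))"
proof -
  note it = PP.internal_tensor[of k 1, unfolded internal_tensor_def]
  have vadd: "v (hadd M n n') = hadd (P 1) (v n) (v n')" if "n \<in> hcar M" "n' \<in> hcar M" for n n'
    using that by (rule ip_preserving_add[OF M.hilbert_module_axioms P.hilbert_module_axioms hmod_isoD(1)[OF v_iso(1)]])
  have vract: "v (ract M n a) = ract (P 1) (v n) a" if "n \<in> hcar M" for n a
    using that by (rule ip_preserving_ract[OF M.hilbert_module_axioms P.hilbert_module_axioms hmod_isoD(1)[OF v_iso(1)]])
  have "{\<tau> k 1 q (v n) | q n. q \<in> hcar (P k) \<and> n \<in> hcar M} = {\<tau> k 1 q r | q r. q \<in> hcar (P k) \<and> r \<in> hcar (P 1)}"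
    unfolding hmod_isoD(2)[OF v_iso(1), symmetric] by blast
  then show ?thesis
    unfolding internal_tensor_def
    using it M v_closed
    by (simp add: vadd vract v_iso(2)[symmetric] M.lact_closed ip_preserving_ip[OF hmod_isoD(1)[OF v_iso(1)], symmetric])
qed

text \<open>Induction on \<open>k\<close> by splitting a tuple into head and tail. It starts from
  the one-element frame \<open>u 1\<close> of the algebra, indexed by the empty tuple.\<close>

lemma parseval_frame_el:
  assumes m: "parseval_frame M J m"
  shows "parseval_frame (P k) (tuples k J) (\<lambda>js. el (map m js))"
proof (induction k)
  case 0
  have "((\<lambda>js. ip (P 0) x (el (map m js)) * ip (P 0) (el (map m js)) x) has_sum ip (P 0) x x) {[]}"
    if "x \<in> hcar (P 0)" for x
  proof -
    have "x \<in> range u"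
      using that hmod_isoD(2)[OF u_iso(1)] by (simp add: trivial_corr_def)
    then show ?thesis by (intro has_sum_finiteI) (auto simp: ip_u star_one)
  qed
  moreover have "tuples 0 J = {[]}" by (auto simp: tuples_def)
  ultimately show ?case
    by (simp add: parseval_frame_def u_closed P.hilbert_module_axioms)
next
  case (Suc k)
  have bij: "bij_betw (\<lambda>js. (hd js, tl js)) (tuples (Suc k) J) (J \<times> tuples k J)"
    by (rule bij_betw_byWitness[where f'="\<lambda>(j, js). j # js"])
       (auto simp: tuples_def length_Suc_conv)
  have "parseval_frame (P (1 + k)) (J \<times> tuples k J) (\<lambda>(j, js). \<tau> 1 k ((v \<circ> m) j) (el (map m js)))"
    by (rule PP.parseval_frame_tensor[OF parseval_frame_iso[OF m P.hilbert_module_axioms v_iso(1)] Suc])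
  from parseval_frame_reindex[OF this bij, of "\<lambda>js. el (map m js)"]
  show ?case by (force simp: tuples_def length_Suc_conv)
qed

text \<open>The product of the first factors acts on the remaining ones: 0 kills them, and 1 fixes
  elementary tensors by \<open>lact_one_el\<close>.\<close>

lemma ip_el:
  assumes m: "\<And>i j. i \<in> J \<Longrightarrow> j \<in> J \<Longrightarrow> ip M (m i) (m j) = (if i = j then 1 else 0)"
    and mM: "\<And>j. j \<in> J \<Longrightarrow> m j \<in> hcar M"
  shows "is \<in> tuples k J \<Longrightarrow> js \<in> tuples k J \<Longrightarrow>
    ip (P k) (el (map m is)) (el (map m js)) = (if is = js then 1 else 0)"
proof (induction k arbitrary: "is" js)
  case 0
  then show ?case by (simp add: tuples_def ip_u star_one)
next
  case (Suc k)
  then obtain i is' j js' where eq: "is = i # is'" "js = j # js'"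
      and tup: "i \<in> J" "j \<in> J" "is' \<in> tuples k J" "js' \<in> tuples k J"
    by (auto simp: tuples_def length_Suc_conv)
  have cl: "el (map m ks) \<in> hcar (P k)" "lact (P k) 1 (el (map m ks)) = el (map m ks)"
    if "ks \<in> tuples k J" for ks
  proof -
    have "set (map m ks) \<subseteq> hcar M" "length (map m ks) = k"
      using that mM by (auto simp: tuples_def)
    then show "el (map m ks) \<in> hcar (P k)" "lact (P k) 1 (el (map m ks)) = el (map m ks)"
      using el_closed lact_one_el by blast+
  qed
  have len: "length is' = k" "length js' = k" using tup by (simp_all add: tuples_def)
  have "ip (P (1 + k)) (\<tau> 1 k (v (m i)) (el (map m is'))) (\<tau> 1 k (v (m j)) (el (map m js')))
      = ip (P k) (el (map m is')) (lact (P k) (ip (P 1) (v (m i)) (v (m j))) (el (map m js')))"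
    by (rule PP.ip_t) (simp_all add: v_closed mM tup cl del: One_nat_def)
  also have "ip (P 1) (v (m i)) (v (m j)) = (if i = j then 1 else 0)"
    using ip_preserving_ip[OF hmod_isoD(1)[OF v_iso(1)]] mM tup m by simp
  finally show ?case
    using cl tup Suc.IH by (auto simp: eq len P.lact_zero P.ip_zero_right)
qed

end

section \<open>The range of \<open>Q\<close> and the powers of the dilation\<close>

locale scaling_system = tensor_power_system M P u v \<tau>
  for M :: "('m, 'a::unital_cstar_algebra) corr" and P :: "nat \<Rightarrow> ('t, 'a) corr" and u v \<tau> +
  fixes m0 :: 'm
    and X :: "('x, 'a) hmod"
    and W :: "nat \<Rightarrow> ('w, 'a) hmod" and \<sigma> :: "nat \<Rightarrow> 'x \<Rightarrow> 't \<Rightarrow> 'w"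
    and \<rho> :: "nat \<Rightarrow> 'w \<Rightarrow> 't \<Rightarrow> 'w"
    and D :: "'x \<Rightarrow> 'w" and \<phi> :: "'x"
    and Minf :: "('l, 'a) hmod" and \<iota> :: "nat \<Rightarrow> 't \<Rightarrow> 'l"
    and MinfM :: "('s, 'a) hmod" and t :: "'l \<Rightarrow> 'm \<Rightarrow> 's"
    and R :: "'l \<Rightarrow> 's" and Q :: "'l \<Rightarrow> 'x"
  assumes m0: "m0 \<in> hcar M"
    and with_powers: "tensor_with_powers X P \<tau> W \<sigma> \<rho>"
    and scaling: "scaling_function M m0 (W 1) (\<lambda>x n. \<sigma> 1 x (v n)) X D \<phi>"
    and limit: "direct_limit P (\<lambda>k p. \<tau> 1 k (v m0) p) Minf \<iota>"
    and MinfM: "internal_tensor Minf M MinfM t"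
    and R: "\<forall>k. \<forall>p\<in>hcar (P (Suc k)).
           R (\<iota> (Suc k) p) = tensor_id (P k) M (P (Suc k)) (\<lambda>q n. \<tau> k 1 q (v n)) MinfM t (\<iota> k) p"
    and Q: "ip_preserving Minf X Q"
    and Q_unit: "Q (\<iota> 0 (u 1)) = \<phi>"
    and DQ: "\<forall>y\<in>hcar Minf.
           D (Q y) = tensor_id Minf M MinfM t (W 1) (\<lambda>x n. \<sigma> 1 x (v n)) Q (R y)"
begin

sublocale X: hilbert_module X using scaling by (simp add: scaling_function_def)
sublocale Minf: hilbert_module Minf using limit by (simp add: direct_limit_def)
sublocale XP: tensor_product X "P k" "W k" "\<sigma> k" for k
  using with_powers by unfold_locales (simp add: tensor_with_powers_def)

lemma internal_tensor_W: "internal_tensor (W 1) (P k) (W (Suc k)) (\<rho> k)"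
  using with_powers by (simp add: tensor_with_powers_def)

lemma assoc_W: "x \<in> hcar X \<Longrightarrow> p \<in> hcar (P 1) \<Longrightarrow> q \<in> hcar (P k) \<Longrightarrow>
    \<rho> k (\<sigma> 1 x p) q = \<sigma> (Suc k) x (\<tau> 1 k p q)"
  using with_powers by (simp add: tensor_with_powers_def)

lemma ip_preserving_D: "ip_preserving X (W 1) D" and internal_tensor_X_M: "internal_tensor X M (W 1) (\<lambda>x n. \<sigma> 1 x (v n))"
  using scaling by (simp_all add: scaling_function_def hmod_iso_def)

lemma \<iota>_compatible: "ip_preserving (P k) Minf (\<iota> k)" "p \<in> hcar (P k) \<Longrightarrow> \<iota> (Suc k) (\<tau> 1 k (v m0) p) = \<iota> k p"
  using limit by (simp_all add: direct_limit_def)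

abbreviation Dpow :: "nat \<Rightarrow> 'x \<Rightarrow> 'w" where "Dpow \<equiv> dilation_power X P u W \<sigma> \<rho> D"

definition E :: "nat \<Rightarrow> 't \<Rightarrow> 'x" where "E k p = Q (\<iota> k p)"

lemma E_closed: "p \<in> hcar (P k) \<Longrightarrow> E k p \<in> hcar X"
  unfolding E_def by (rule ip_preserving_closed[OF Q ip_preserving_closed[OF \<iota>_compatible(1)]])

lemma ip_E: "p \<in> hcar (P k) \<Longrightarrow> q \<in> hcar (P k) \<Longrightarrow> ip X (E k p) (E k q) = ip (P k) p q"
  unfolding E_def using ip_preserving_ip[OF Q] ip_preserving_ip[OF \<iota>_compatible(1)] ip_preserving_closed[OF \<iota>_compatible(1)] by simp

lemma E_Suc: "p \<in> hcar (P k) \<Longrightarrow> E (Suc k) (\<tau> 1 k (v m0) p) = E k p"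
  by (simp only: E_def \<iota>_compatible(2))

text \<open>Used to lift an element to a level at which all tuples of a given finite set
  occur.\<close>

lemma E_mono: "p \<in> hcar (P k) \<Longrightarrow> k \<le> l \<Longrightarrow> \<exists>q\<in>hcar (P l). E k p = E l q"
proof (rotate_tac, induction l rule: dec_induct)
  case (step l)
  then obtain q where "q \<in> hcar (P l)" "E k p = E l q" by blast
  then show ?case
    using E_Suc[of q l] tensor_closed[OF v_closed[OF m0], of q l] by (intro bexI[of _ "\<tau> 1 l (v m0) q"]) auto
qed blast

text \<open>The relations for \<open>R\<close> and for \<open>D \<circ> Q\<close> combine:
  \<open>R\<close> splits off the last tensor factor, and \<open>Q \<otimes> id\<close> maps what is
  left into \<open>X\<close>.\<close>

lemma D_E:
  assumes q: "q \<in> hcar (P k)" and n: "n \<in> hcar M"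
  shows "D (E (Suc k) (\<tau> k 1 q (v n))) = \<sigma> 1 (E k q) (v n)"
proof -
  have p: "\<tau> k 1 q (v n) \<in> hcar (P (Suc k))"
    using tensor_closed[OF q v_closed[OF n]] by simp
  have "R (\<iota> (Suc k) (\<tau> k 1 q (v n))) = t (\<iota> k q) n"
    using R p tensor_id_apply[OF internal_tensor_P_M MinfM \<iota>_compatible(1) q n] by simp
  moreover have "\<iota> (Suc k) (\<tau> k 1 q (v n)) \<in> hcar Minf" "\<iota> k q \<in> hcar Minf"
    using p q ip_preserving_closed[OF \<iota>_compatible(1)] by blast+
  ultimately show ?thesis
    unfolding E_def using DQ tensor_id_apply[OF MinfM internal_tensor_X_M Q _ n, of "\<iota> k q"] by simp
qed

text \<open>Its purpose is the injectivity behind \<open>inv_into\<close>. The exponent starts at 1,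
  the empty tuple having its own value \<open>\<phi>\<close>.\<close>

lemma ip_preserving_Dpow: "ip_preserving X (W (Suc k)) (Dpow (Suc k))"
proof (induction k)
  case 0
  show ?case using ip_preserving_D by simp
next
  case (Suc k)
  have "ip_preserving (W (Suc k)) (W (Suc (Suc k)))
      (tensor_id X (P (Suc k)) (W (Suc k)) (\<sigma> (Suc k)) (W (Suc (Suc k))) (\<rho> (Suc k)) D)"
    by (rule ip_preserving_tensor_id[OF XP.internal_tensor internal_tensor_W ip_preserving_D])
  then show ?case using Suc by (simp add: ip_preserving_def)
qed

text \<open>
  With \<open>j = 0\<close> and \<open>q = 1\<close> this computes \<open>D\<^sup>k\<close> on the image of \<open>M\<^bsup>\<otimes>k\<^esup>\<close>; the general form is
  needed because \<open>D\<^sup>k\<close> splits off the tensor factors from the left whereas \<open>R\<close> splits off the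
  last one.
\<close>

lemma Dpow_E:
  "set ns \<subseteq> hcar M \<Longrightarrow> q \<in> hcar (P j) \<Longrightarrow>
    Dpow (length ns) (E (j + length ns) (\<tau> j (length ns) q (el ns))) = \<sigma> (length ns) (E j q) (el ns)"
proof (induction ns arbitrary: j q)
  case Nil
  then show ?case by (simp add: unit_right P.ract_one)
next
  case (Cons n ns)
  have n: "n \<in> hcar M" "v n \<in> hcar (P 1)" and ns: "set ns \<subseteq> hcar M" "el ns \<in> hcar (P (length ns))"
    using Cons.prems v_closed el_closed by auto
  show ?case
  \<comment> \<open>\<open>dilation_power\<close> has a separate clause for exponent 1 and recurses
    only from 2 on, so a single factor is settled by \<open>D_E\<close> directly.\<close>
  proof (cases ns)
    case Nil
    have "\<tau> 1 0 (v n) (u 1) = v n" using n(2) by (simp add: unit_right P.ract_one del: One_nat_def)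
    then show ?thesis using D_E[OF Cons.prems(2) n(1)] Nil by simp
  next
    case (Cons n' ns')
    define k where "k = length ns"
    obtain k' where k': "k = Suc k'" by (simp add: k_def Cons)
    have q': "\<tau> j 1 q (v n) \<in> hcar (P (Suc j))" using tensor_closed[OF Cons.prems(2) n(2)] by simp
    have IH: "Dpow k (E (Suc j + k) (\<tau> (Suc j) k (\<tau> j 1 q (v n)) (el ns)))
        = \<sigma> k (E (Suc j) (\<tau> j 1 q (v n))) (el ns)"
      unfolding k_def by (rule Cons.IH[OF ns(1) q'])
    \<comment> \<open>Associativity regroups \<open>n\<close> with \<open>q\<close>, so that the
      induction hypothesis at \<open>j + 1\<close> strips the tail \<open>ns\<close>; one further
      application of \<open>D\<close> then releases \<open>n\<close>.\<close>
    have "\<tau> (Suc j) k (\<tau> j 1 q (v n)) (el ns) = \<tau> j (Suc k) q (\<tau> 1 k (v n) (el ns))"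
      using assoc[OF Cons.prems(2) n(2), of "el ns" k] ns by (simp add: k_def)
    then have "Dpow (Suc k) (E (Suc j + k) (\<tau> j (Suc k) q (\<tau> 1 k (v n) (el ns))))
        = tensor_id X (P k) (W k) (\<sigma> k) (W (Suc k)) (\<rho> k) D (\<sigma> k (E (Suc j) (\<tau> j 1 q (v n))) (el ns))"
      using IH by (simp add: k' del: One_nat_def)
    also have "\<dots> = \<rho> k (D (E (Suc j) (\<tau> j 1 q (v n)))) (el ns)"
      by (rule tensor_id_apply[OF XP.internal_tensor internal_tensor_W ip_preserving_D]) (use E_closed[OF q'] ns in \<open>simp_all add: k_def\<close>)
    also have "\<dots> = \<sigma> (Suc k) (E j q) (\<tau> 1 k (v n) (el ns))"
      using D_E[OF Cons.prems(2) n(1)] assoc_W[OF E_closed[OF Cons.prems(2)] n(2)] ns by (simp add: k_def)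
    finally show ?thesis by (simp add: k_def)
  qed
qed

text \<open>\<open>Dpow_E\<close> with \<open>q = u 1\<close> exhibits a preimage, after the
  essential left action has absorbed the unit; injectivity makes it the one that
  \<open>inv_into\<close> picks.\<close>

lemma frame_element_eq:
  assumes m: "\<And>j. j \<in> J \<Longrightarrow> m j \<in> hcar M" and js: "set js \<subseteq> J"
  shows "frame_element X P u v \<tau> W \<sigma> \<rho> D \<phi> m js = E (length js) (el (map m js))"
proof (cases "js = []")
  case False
  define ns where "ns = map m js"
  have ns: "set ns \<subseteq> hcar M" using m js by (auto simp: ns_def)
  have len: "length ns = length js" by (simp add: ns_def)
  have cl: "el ns \<in> hcar (P (length ns))" by (rule el_closed[OF ns])
  have "E 0 (u 1) = \<phi>" by (simp add: E_def Q_unit)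
  then have "Dpow (length ns) (E (length ns) (el ns)) = \<sigma> (length ns) \<phi> (el ns)"
    using Dpow_E[OF ns u_closed[of 1]] unit_left[OF cl, of 1] lact_one_el[OF ns] by simp
  moreover have "inj_on (Dpow (length ns)) (hcar X)"
  proof -
    obtain k where k: "length ns = Suc k" using False len by (cases js) auto
    show ?thesis
      unfolding k
      by (rule ip_preserving_inj[OF X.hilbert_module_axioms XP.T.hilbert_module_axioms ip_preserving_Dpow])
  qed
  ultimately show ?thesis
    using False E_closed[OF cl] inv_into_f_eq[of "Dpow (length ns)" "hcar X"]
    by (simp add: frame_element_def ns_def)
qed (simp add: frame_element_def E_def Q_unit)

text \<open>Each leading zero is one application of a connecting map, which the direct limit
  identifies with the identity.\<close>

lemma E_pad:
  assumes m: "\<And>j. j \<in> J \<Longrightarrow> m j \<in> hcar M" "m 0 = m0" and js: "set js \<subseteq> J" "length js \<le> k"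
  shows "E k (el (map m (pad k js))) = E (length js) (el (map m js))"
proof -
  have "E (z + length js) (el (map m (replicate z 0 @ js))) = E (length js) (el (map m js))" for z
  proof (induction z)
    case (Suc z)
    have "set (map m (replicate z 0 @ js)) \<subseteq> hcar M" using m m0 js(1) by auto
    then have "el (map m (replicate z 0 @ js)) \<in> hcar (P (z + length js))"
      using el_closed[of "map m (replicate z 0 @ js)"] by simp
    then show ?case using E_Suc[of _ "z + length js"] Suc m(2) by simp
  qed simp
  from this[of "k - length js"] show ?thesis using js(2) by (simp add: pad_def)
qed

abbreviation Z :: "('x, 'a) hmod" where "Z \<equiv> X\<lparr>hcar := Q ` hcar Minf\<rparr>"

lemma hilbert_module_Z: "hilbert_module Z"
  by (rule hilbert_module_image[OF Minf.hilbert_module_axioms X.hilbert_module_axioms Q])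

lemma E_in_Z: "p \<in> hcar (P k) \<Longrightarrow> E k p \<in> hcar Z"
  using ip_preserving_closed[OF \<iota>_compatible(1)] by (simp add: E_def)

lemma hdense_E: "hdense Z (\<Union>k. E k ` hcar (P k))"
proof -
  have hd: "hdist Z = hdist X" by (intro ext) (simp add: hdist_def)
  have "\<exists>y\<in>\<Union>k. E k ` hcar (P k). hdist Z x y < e" if x: "x \<in> hcar Z" and e: "e > 0" for x e
  proof -
    obtain l where l: "l \<in> hcar Minf" "x = Q l" using x by auto
    have "hdense Minf (\<Union>k. \<iota> k ` hcar (P k))" using limit by (simp add: direct_limit_def)
    then have "\<exists>y\<in>\<Union>k. \<iota> k ` hcar (P k). hdist Minf l y < e"
      using l(1) e by (simp only: hdense_def)
    then obtain k p where p: "p \<in> hcar (P k)" "hdist Minf l (\<iota> k p) < e"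
      by auto
    then have "hdist X x (E k p) < e"
      using l ip_preserving_hdist[OF Minf.hilbert_module_axioms X.hilbert_module_axioms Q]
        ip_preserving_closed[OF \<iota>_compatible(1)] by (simp add: E_def)
    then show ?thesis using p by (auto simp: hd)
  qed
  then show ?thesis unfolding hdense_def using E_in_Z by auto
qed

lemma parseval_frame_Z:
  assumes frame: "parseval_frame M J m" and J: "0 \<in> J" and m: "m 0 = m0"
  shows "parseval_frame Z (frame_index J) (\<lambda>js. E (length js) (el (map m js)))"
proof -
  define e where "e js = E (length js) (el (map m js))" for js
  have mM: "m j \<in> hcar M" if "j \<in> J" for j using frame that by (simp add: parseval_frame_def)
  have FI: "set js \<subseteq> J" if "js \<in> frame_index J" for js using that by (auto simp: frame_index_def)
  have eZ: "e js \<in> hcar Z" if "js \<in> frame_index J" for js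
  proof -
    have "set (map m js) \<subseteq> hcar M" using FI[OF that] mM by auto
    then show ?thesis unfolding e_def using E_in_Z[OF el_closed[of "map m js"]] by simp
  qed
  interpret Z: hilbert_module Z by (rule hilbert_module_Z)
  have pos: "positive (ip X x (e js) * ip X (e js) x)" if "js \<in> frame_index J" "x \<in> hcar Z" for js x
    using Z.ip_star[of "e js" x] eZ[OF that(1)] that(2) by (simp add: positive_star_mult_self)
  let ?A = "\<lambda>k. {js \<in> frame_index J. length js \<le> k}"
  \<comment> \<open>Through padding, the frame of \<open>P k\<close> accounts for exactly the tuples
    of length at most \<open>k\<close>.\<close>
  have part: "((\<lambda>js. ip X (E k p) (e js) * ip X (e js) (E k p)) has_sum ip X (E k p) (E k p)) (?A k)"
    if p: "p \<in> hcar (P k)" for k p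
  proof -
    have cl: "el (map m js) \<in> hcar (P k)" if "js \<in> tuples k J" for js
    proof -
      have "set (map m js) \<subseteq> hcar M" "length (map m js) = k" using that mM by (auto simp: tuples_def)
      then show ?thesis using el_closed by blast
    qed
    have "((\<lambda>js. ip (P k) p (el (map m js)) * ip (P k) (el (map m js)) p) has_sum ip (P k) p p) (tuples k J)"
      using parseval_frame_el[OF frame, of k] p by (simp add: parseval_frame_def)
    then have "((\<lambda>js. ip (P k) p (el (map m (pad k js))) * ip (P k) (el (map m (pad k js))) p) has_sum ip (P k) p p) (?A k)"
      using has_sum_reindex_bij_betw[OF bij_betw_pad[OF J, of k],
          of "\<lambda>js. ip (P k) p (el (map m js)) * ip (P k) (el (map m js)) p"] by simp
    then show ?thesis
    proof (rule has_sum_eqI)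
      fix js assume js: "js \<in> ?A k"
      then have "pad k js \<in> tuples k J" using bij_betwE[OF bij_betw_pad[OF J, of k]] by blast
      moreover have "e js = E k (el (map m (pad k js)))"
        unfolding e_def using js FI by (intro E_pad[symmetric] mM m) auto
      ultimately show "ip (P k) p (el (map m (pad k js))) * ip (P k) (el (map m (pad k js))) p
          = ip X (E k p) (e js) * ip X (e js) (E k p)"
        using p cl by (simp add: ip_E)
    qed (simp add: p ip_E)
  qed
  have on_dense: "((\<lambda>js. ip X x (e js) * ip X (e js) x) has_sum ip X x x) (frame_index J)"
    if x: "x \<in> (\<Union>k. E k ` hcar (P k))" for x
  proof -
    obtain k p where p: "p \<in> hcar (P k)" "x = E k p" using x by blast
    have xZ: "x \<in> hcar Z" unfolding p(2) by (rule E_in_Z[OF p(1)])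
    have posA: "positive (ip X x (e js) * ip X (e js) x)" if "js \<in> ?A l" for js l
      using pos[OF _ xZ] that by blast
    have bound: "positive (ip X x x - (\<Sum>js\<in>F. ip X x (e js) * ip X (e js) x))"
      if F: "finite F" "F \<subseteq> frame_index J" for F
    proof -
      \<comment> \<open>A level at which all tuples of \<open>F\<close> occur; inserting
        \<open>k\<close> ensures that \<open>x\<close> can be lifted to it, also when
        \<open>F\<close> is empty.\<close>
      define l where "l = Max (insert k (length ` F))"
      have kl: "k \<le> l" and Fl: "F \<subseteq> ?A l" using F by (auto simp: l_def)
      obtain q where q: "q \<in> hcar (P l)" "x = E l q" using E_mono[OF p(1) kl] p(2) by auto
      show ?thesis
        using iffD1[OF has_sum_positive_iff[OF posA[of _ l]] part[OF q(1), folded q(2)], THEN conjunct1] F(1) Fl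
        by simp
    qed
    \<comment> \<open>Closeness needs no longer tuples: those of length at most \<open>k\<close>
      already sum to \<open>ip X x x\<close>.\<close>
    have approx: "\<exists>F. finite F \<and> F \<subseteq> frame_index J \<and> norm (ip X x x - (\<Sum>js\<in>F. ip X x (e js) * ip X (e js) x)) < d"
      if "d > 0" for d
    proof -
      have "\<exists>F. finite F \<and> F \<subseteq> ?A k \<and> norm (ip X x x - (\<Sum>js\<in>F. ip X x (e js) * ip X (e js) x)) < d"
        using iffD1[OF has_sum_positive_iff[OF posA[of _ k]] part[OF p(1), folded p(2)], THEN conjunct2] that
        by simp
      then obtain F where "finite F" "F \<subseteq> ?A k"
          "norm (ip X x x - (\<Sum>js\<in>F. ip X x (e js) * ip X (e js) x)) < d"
        by auto
      then show ?thesis by blast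
    qed
    show ?thesis
      using has_sum_positive_iff[of "frame_index J" "\<lambda>js. ip X x (e js) * ip X (e js) x" "ip X x x", OF pos[OF _ xZ]]
        bound approx by blast
  qed
  have "parseval_frame Z (frame_index J) e"
    unfolding parseval_frame_def
    using hilbert_module_Z countable_frame_index eZ
      parseval_on_dense[where Z=Z and f=e and I="frame_index J", OF hilbert_module_Z eZ hdense_E] on_dense
    by simp
  then show ?thesis by (simp add: e_def[abs_def])
qed

lemma orthonormal_basis_Z:
  assumes frame: "parseval_frame M J m" and J: "0 \<in> J" and m: "m 0 = m0"
    and on: "\<And>i j. i \<in> J \<Longrightarrow> j \<in> J \<Longrightarrow> ip M (m i) (m j) = (if i = j then 1 else 0)"
  shows "orthonormal_basis Z (frame_index J) (\<lambda>js. E (length js) (el (map m js)))"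
proof (rule orthonormal_basis_of_parseval_frame[OF parseval_frame_Z[OF frame J m]])
  have mM: "m j \<in> hcar M" if "j \<in> J" for j using frame that by (simp add: parseval_frame_def)
  fix "is" js assume ij: "is \<in> frame_index J" "js \<in> frame_index J"
  \<comment> \<open>Tuples of different lengths are compared at a common level, where both become
    elementary tensors of length \<open>k\<close>.\<close>
  define k where "k = max (length is) (length js)"
  have tup: "pad k ks \<in> tuples k J \<and> E (length ks) (el (map m ks)) = E k (el (map m (pad k ks)))
      \<and> el (map m (pad k ks)) \<in> hcar (P k)"
    if "ks \<in> frame_index J" "length ks \<le> k" for ks
  proof -
    have t: "pad k ks \<in> tuples k J" using bij_betwE[OF bij_betw_pad[OF J, of k]] that by blast
    then have "set (map m (pad k ks)) \<subseteq> hcar M" "length (map m (pad k ks)) = k"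
      using mM by (auto simp: tuples_def)
    then have "el (map m (pad k ks)) \<in> hcar (P k)" using el_closed[of "map m (pad k ks)"] by simp
    moreover have "set ks \<subseteq> J" using that(1) by (auto simp: frame_index_def)
    ultimately show ?thesis using t E_pad[of J m ks k, OF mM m _ that(2)] by simp
  qed
  \<comment> \<open>Padding is injective on indices, since dropping the leading zeros undoes
    it.\<close>
  have "pad k is = pad k js \<longleftrightarrow> is = js" using dropWhile_pad ij by metis
  then show "ip Z (E (length is) (el (map m is))) (E (length js) (el (map m js))) = (if is = js then 1 else 0)"
    using tup[OF ij(1)] tup[OF ij(2)] ip_el[of J m "pad k is" k "pad k js", OF on mM] by (simp add: k_def ip_E)
qed

end

lemma parseval_frame_cong:
  "(\<And>j. j \<in> J \<Longrightarrow> f j = g j) \<Longrightarrow> parseval_frame Z J f = parseval_frame Z J g"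
  by (auto intro: parseval_frame_reindex[OF _ bij_betw_id] simp: bij_betw_def)

lemma orthonormal_basis_cong:
  "(\<And>j. j \<in> J \<Longrightarrow> f j = g j) \<Longrightarrow> orthonormal_basis Z J f = orthonormal_basis Z J g"
  unfolding orthonormal_basis_def by (simp cong: image_cong)

theorem corollary4p5:
  fixes M :: "('m, 'a::unital_cstar_algebra) corr"
    and J :: "nat set" and m :: "nat \<Rightarrow> 'm"
    and P :: "nat \<Rightarrow> ('t, 'a) corr" and u :: "'a \<Rightarrow> 't" and v :: "'m \<Rightarrow> 't"
    and \<tau> :: "nat \<Rightarrow> nat \<Rightarrow> 't \<Rightarrow> 't \<Rightarrow> 't"
    and X :: "('x, 'a) hmod"
    and W :: "nat \<Rightarrow> ('w, 'a) hmod" and \<sigma> :: "nat \<Rightarrow> 'x \<Rightarrow> 't \<Rightarrow> 'w"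
    and \<rho> :: "nat \<Rightarrow> 'w \<Rightarrow> 't \<Rightarrow> 'w"
    and D :: "'x \<Rightarrow> 'w" and \<phi> :: "'x"
    and Minf :: "('l, 'a) hmod" and \<iota> :: "nat \<Rightarrow> 't \<Rightarrow> 'l"
    and MinfM :: "('s, 'a) hmod" and t :: "'l \<Rightarrow> 'm \<Rightarrow> 's"
    and R :: "'l \<Rightarrow> 's" and Q :: "'l \<Rightarrow> 'x"
  assumes "correspondence M" and "essential M"
    and J: "J = UNIV \<or> (\<exists>N>0. J = {..<N})"
    and "parseval_frame M J m" and "ip M (m 0) (m 0) = 1"
    and "tensor_powers M P u v \<tau>"
    and "tensor_with_powers X P \<tau> W \<sigma> \<rho>"
    and "scaling_function M (m 0) (W 1) (\<lambda>x n. \<sigma> 1 x (v n)) X D \<phi>"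
    and "direct_limit P (\<lambda>k p. \<tau> 1 k (v (m 0)) p) Minf \<iota>"
    and "internal_tensor Minf M MinfM t"
    and "hmod_iso Minf MinfM R"
    and "\<forall>k. \<forall>p\<in>hcar (P (Suc k)).
           R (\<iota> (Suc k) p) = tensor_id (P k) M (P (Suc k)) (\<lambda>q n. \<tau> k 1 q (v n)) MinfM t (\<iota> k) p"
    and "ip_preserving Minf X Q"
    and "Q (\<iota> 0 (u 1)) = \<phi>"
    and "\<forall>y\<in>hcar Minf.
           D (Q y) = tensor_id Minf M MinfM t (W 1) (\<lambda>x n. \<sigma> 1 x (v n)) Q (R y)"
  shows "parseval_frame (X\<lparr>hcar := Q ` hcar Minf\<rparr>) (frame_index J)
           (frame_element X P u v \<tau> W \<sigma> \<rho> D \<phi> m) \<and>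
         (orthonormal_basis M J m \<longrightarrow>
           orthonormal_basis (X\<lparr>hcar := Q ` hcar Minf\<rparr>) (frame_index J)
             (frame_element X P u v \<tau> W \<sigma> \<rho> D \<phi> m))"
proof -
  have J0: "0 \<in> J" using J by auto
  have mM: "m j \<in> hcar M" if "j \<in> J" for j
    using \<open>parseval_frame M J m\<close> that by (simp add: parseval_frame_def)
  interpret scaling_system M P u v \<tau> "m 0" X W \<sigma> \<rho> D \<phi> Minf \<iota> MinfM t R Q
    by (intro scaling_system.intro tensor_power_system.intro scaling_system_axioms.intro)
       (fact assms mM[OF J0])+
  have eq: "frame_element X P u v \<tau> W \<sigma> \<rho> D \<phi> m js = E (length js) (el (map m js))"
    if "js \<in> frame_index J" for js
    by (rule frame_element_eq[OF mM]) (use that in \<open>auto simp: frame_index_def\<close>)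
  have "parseval_frame Z (frame_index J) (frame_element X P u v \<tau> W \<sigma> \<rho> D \<phi> m)"
    using parseval_frame_Z[OF \<open>parseval_frame M J m\<close> J0 refl] by (subst parseval_frame_cong[OF eq])
  moreover have "orthonormal_basis Z (frame_index J) (frame_element X P u v \<tau> W \<sigma> \<rho> D \<phi> m)"
    if "orthonormal_basis M J m"
  proof -
    have on: "ip M (m i) (m j) = (if i = j then 1 else 0)" if "i \<in> J" "j \<in> J" for i j
      using \<open>orthonormal_basis M J m\<close> that unfolding orthonormal_basis_def by blast
    show ?thesis
      using orthonormal_basis_Z[OF \<open>parseval_frame M J m\<close> J0 refl on] by (subst orthonormal_basis_cong[OF eq])
  qed
  ultimately show ?thesis by blast
qed

end
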